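(* Given a cograph $G$ with $n$ vertices and $m$ edges, an integer well-covering system of $G$ with size at most $n-1$ can be computed in time $\mathcal{O}(n(n+m))$.
   Context: All graphs are finite, simple, and undirected. A cograph is a graph that can be constructed from copies of the one-vertex graph using the operations of disjoint union and complementation. An independent set is a set of pairwise nonadjacent vertices; it is maximal if it is not contained in any larger independent set. A weight function $w:V(G)\to\mathbb{R}$ is a well-covered weighting of $G$ if all maximal independent sets $I$ of $G$ have the same weight $w(I)=\sum_{v\in I}w(v)$. A well-covering system of $G$ is a system $\mathcal{S}$ of homogeneous linear equations with real coefficients over the variables $\{x_v: v\in V(G)\}$ such that $w:V(G)\to\mathbb{R}$ is a well-covered weighting of $G$ if and only if setting $x_v=w(v)$ for all $v\in V(G)$ satisfies all equations of $\mathcal{S}$. Its size is its number of equations. It is integer if all its coefficients are integers. *)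

theory Defs
  imports Complex_Main
begin

record 'a graph =
  verts :: "'a set"
  edges :: "'a set set"

definition simple_graph :: "'a graph \<Rightarrow> bool" where
  "simple_graph G \<longleftrightarrow> finite (verts G) \<and>
     (\<forall>e\<in>edges G. \<exists>u\<in>verts G. \<exists>v\<in>verts G. u \<noteq> v \<and> e = {u, v})"

definition graph_complement :: "'a graph \<Rightarrow> 'a graph" where
  "graph_complement G = \<lparr>verts = verts G,
     edges = {{u, v} | u v. u \<in> verts G \<and> v \<in> verts G \<and> u \<noteq> v \<and> {u, v} \<notin> edges G}\<rparr>"

definition graph_union :: "'a graph \<Rightarrow> 'a graph \<Rightarrow> 'a graph" where
  "graph_union G H = \<lparr>verts = verts G \<union> verts H, edges = edges G \<union> edges H\<rparr>"

inductive cograph :: "'a graph \<Rightarrow> bool" where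
  single: "cograph \<lparr>verts = {v}, edges = {}\<rparr>"
| disjoint_union:
    "\<lbrakk>cograph G; cograph H; verts G \<inter> verts H = {}\<rbrakk> \<Longrightarrow> cograph (graph_union G H)"
| complement: "cograph G \<Longrightarrow> cograph (graph_complement G)"

definition independent :: "'a graph \<Rightarrow> 'a set \<Rightarrow> bool" where
  "independent G I \<longleftrightarrow> I \<subseteq> verts G \<and> (\<forall>u\<in>I. \<forall>v\<in>I. u \<noteq> v \<longrightarrow> {u, v} \<notin> edges G)"

definition maximal_independent :: "'a graph \<Rightarrow> 'a set \<Rightarrow> bool" where
  "maximal_independent G I \<longleftrightarrow>
     independent G I \<and> (\<forall>J. independent G J \<and> I \<subseteq> J \<longrightarrow> J = I)"

definition well_covered_weighting :: "'a graph \<Rightarrow> ('a \<Rightarrow> real) \<Rightarrow> bool" where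
  "well_covered_weighting G w \<longleftrightarrow>
     (\<forall>I J. maximal_independent G I \<and> maximal_independent G J \<longrightarrow> sum w I = sum w J)"

text \<open>
  The equation with coefficients \<open>a\<close> is \<open>\<Sum>v\<in>verts G. a v * x v = 0\<close>; a system is a list of
  equations, and its size is the length of the list.
\<close>

type_synonym 'a equation = "'a \<Rightarrow> real"

definition well_covering_system :: "'a graph \<Rightarrow> 'a equation list \<Rightarrow> bool" where
  "well_covering_system G S \<longleftrightarrow>
     (\<forall>w. well_covered_weighting G w \<longleftrightarrow> (\<forall>a\<in>set S. (\<Sum>v\<in>verts G. a v * w v) = 0))"

definition integer_system :: "'a graph \<Rightarrow> 'a equation list \<Rightarrow> bool" where
  "integer_system G S \<longleftrightarrow> (\<forall>a\<in>set S. \<forall>v\<in>verts G. a v \<in> \<int>)"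


text \<open>
  The model of computation is a unit-cost random access machine, programmed in a deterministic
  while language with finitely many (per program) integer variables and integer arrays. Every
  operation of an expression, every memory access and every control step costs one unit. The
  parameter \<open>W\<close> is the largest absolute value that a machine word can hold: a program whose
  evaluation produces a larger constant, intermediate result or address, or that uses a negative
  address, has no execution. Taking \<open>W\<close> polynomial in the input size gives the usual machine
  with words of logarithmic length and so excludes gaining time by arithmetic on long numbers.
\<close>

record state =
  var :: "string \<Rightarrow> int"
  arr :: "string \<Rightarrow> nat \<Rightarrow> int"

datatype aexp = Const int | Var string | Read string aexp
  | Plus aexp aexp | Minus aexp aexp | Times aexp aexp

datatype bexp = Less aexp aexp | Equal aexp aexp | Neg bexp | And bexp bexp

datatype com = Skip
  | Assign string aexp
  | Write string aexp aexp
  | Seq com com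
  | Cond bexp com com
  | While bexp com

primrec aval :: "aexp \<Rightarrow> state \<Rightarrow> int" where
  "aval (Const k) s = k"
| "aval (Var x) s = var s x"
| "aval (Read a e) s = arr s a (nat (aval e s))"
| "aval (Plus e f) s = aval e s + aval f s"
| "aval (Minus e f) s = aval e s - aval f s"
| "aval (Times e f) s = aval e s * aval f s"

primrec bval :: "bexp \<Rightarrow> state \<Rightarrow> bool" where
  "bval (Less e f) s \<longleftrightarrow> aval e s < aval f s"
| "bval (Equal e f) s \<longleftrightarrow> aval e s = aval f s"
| "bval (Neg b) s \<longleftrightarrow> \<not> bval b s"
| "bval (And b d) s \<longleftrightarrow> bval b s \<and> bval d s"

primrec asafe :: "nat \<Rightarrow> aexp \<Rightarrow> state \<Rightarrow> bool" where
  "asafe W (Const k) s \<longleftrightarrow> \<bar>k\<bar> \<le> int W"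
| "asafe W (Var x) s \<longleftrightarrow> \<bar>var s x\<bar> \<le> int W"
| "asafe W (Read a e) s \<longleftrightarrow>
     asafe W e s \<and> 0 \<le> aval e s \<and> \<bar>aval (Read a e) s\<bar> \<le> int W"
| "asafe W (Plus e f) s \<longleftrightarrow> asafe W e s \<and> asafe W f s \<and> \<bar>aval (Plus e f) s\<bar> \<le> int W"
| "asafe W (Minus e f) s \<longleftrightarrow> asafe W e s \<and> asafe W f s \<and> \<bar>aval (Minus e f) s\<bar> \<le> int W"
| "asafe W (Times e f) s \<longleftrightarrow> asafe W e s \<and> asafe W f s \<and> \<bar>aval (Times e f) s\<bar> \<le> int W"

primrec bsafe :: "nat \<Rightarrow> bexp \<Rightarrow> state \<Rightarrow> bool" where
  "bsafe W (Less e f) s \<longleftrightarrow> asafe W e s \<and> asafe W f s"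
| "bsafe W (Equal e f) s \<longleftrightarrow> asafe W e s \<and> asafe W f s"
| "bsafe W (Neg b) s \<longleftrightarrow> bsafe W b s"
| "bsafe W (And b d) s \<longleftrightarrow> bsafe W b s \<and> bsafe W d s"

primrec acost :: "aexp \<Rightarrow> nat" where
  "acost (Const k) = 1"
| "acost (Var x) = 1"
| "acost (Read a e) = acost e + 1"
| "acost (Plus e f) = acost e + acost f + 1"
| "acost (Minus e f) = acost e + acost f + 1"
| "acost (Times e f) = acost e + acost f + 1"

primrec bcost :: "bexp \<Rightarrow> nat" where
  "bcost (Less e f) = acost e + acost f + 1"
| "bcost (Equal e f) = acost e + acost f + 1"
| "bcost (Neg b) = bcost b + 1"
| "bcost (And b d) = bcost b + bcost d + 1"

text \<open>
  \<open>exec W c s t s'\<close>: with word bound \<open>W\<close>, program \<open>c\<close> started in \<open>s\<close> halts in \<open>s'\<close> after \<open>t\<close> steps.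
\<close>

inductive exec :: "nat \<Rightarrow> com \<Rightarrow> state \<Rightarrow> nat \<Rightarrow> state \<Rightarrow> bool" for W :: nat where
  Skip: "exec W Skip s 1 s"
| Assign: "asafe W e s \<Longrightarrow>
    exec W (Assign x e) s (acost e + 1) (s\<lparr>var := (var s)(x := aval e s)\<rparr>)"
| Write: "\<lbrakk>asafe W i s; 0 \<le> aval i s; asafe W e s\<rbrakk> \<Longrightarrow>
    exec W (Write a i e) s (acost i + acost e + 1)
      (s\<lparr>arr := (arr s)(a := (arr s a)(nat (aval i s) := aval e s))\<rparr>)"
| Seq: "\<lbrakk>exec W c s t s'; exec W d s' t' s''\<rbrakk> \<Longrightarrow> exec W (Seq c d) s (t + t') s''"
| CondTrue: "\<lbrakk>bsafe W b s; bval b s; exec W c s t s'\<rbrakk> \<Longrightarrow>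
    exec W (Cond b c d) s (bcost b + t + 1) s'"
| CondFalse: "\<lbrakk>bsafe W b s; \<not> bval b s; exec W d s t s'\<rbrakk> \<Longrightarrow>
    exec W (Cond b c d) s (bcost b + t + 1) s'"
| WhileFalse: "\<lbrakk>bsafe W b s; \<not> bval b s\<rbrakk> \<Longrightarrow> exec W (While b c) s (bcost b + 1) s"
| WhileTrue: "\<lbrakk>bsafe W b s; bval b s; exec W c s t s'; exec W (While b c) s' t' s''\<rbrakk> \<Longrightarrow>
    exec W (While b c) s (bcost b + t + t' + 1) s''"


text \<open>
  Input: \<open>vs\<close> numbers the vertices by \<open>0, \<dots>, n - 1\<close>, and \<open>L ! i\<close> lists the numbers of the
  neighbours of vertex \<open>i\<close> in arbitrary order. The machine gets \<open>n\<close>, the concatenation of the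
  lists in \<open>L\<close>, and the positions at which the individual lists start. All other memory is zero.
\<close>

definition adjacency_lists :: "'a graph \<Rightarrow> 'a list \<Rightarrow> nat list list \<Rightarrow> bool" where
  "adjacency_lists G vs L \<longleftrightarrow>
     distinct vs \<and> set vs = verts G \<and> length L = length vs \<and>
     (\<forall>i<length vs. distinct (L ! i) \<and>
        set (L ! i) = {j. j < length vs \<and> {vs ! i, vs ! j} \<in> edges G})"

definition input_state :: "nat list list \<Rightarrow> state" where
  "input_state L = \<lparr>
     var = (\<lambda>x. if x = ''n'' then int (length L) else 0),
     arr = (\<lambda>a k.
       if a = ''start'' \<and> k \<le> length L then int (length (concat (take k L)))
       else if a = ''adj'' \<and> k < length (concat L) then int (concat L ! k)
       else 0)\<rparr>"

text \<open>
  Output: the number of equations, and the coefficients of the system row by row, with all \<open>n\<close>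
  coefficients of each equation written out.
\<close>

definition outputs_system :: "'a list \<Rightarrow> state \<Rightarrow> 'a equation list \<Rightarrow> bool" where
  "outputs_system vs s S \<longleftrightarrow>
     var s ''size'' = int (length S) \<and>
     (\<forall>i<length S. \<forall>j<length vs.
        (S ! i) (vs ! j) = of_int (arr s ''coeff'' (i * length vs + j)))"

end

(* Every set of at least two vertices of a cograph contains twins, that is, two vertices with the same
   neighbours in the rest of the set. If u and v are false twins, a maximal independent set contains
   both or neither, so v can be deleted after its weight is added to that of u. If they are true
   twins, exchanging them preserves maximal independence, so v can be deleted at the cost of the
   equation w(u) = w(v). Deleting twins until one vertex remains yields at most n - 1 equations, whose
   coefficients over the original vertices are in {-1, 0, 1}. Each twin pair is found in time O(n + m)
   by partition refinement: starting from one class, split the classes by the neighbourhood (open for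
   false, closed for true twins) of every remaining vertex; vertices in the same final class are
   twins. *)

theory Submission
  imports Defs
begin

section \<open>Total correctness with running time\<close>

text \<open>A refinement may cost only O(n + m), so the tables \<open>new\<close> and
  \<open>seen\<close>, which are indexed by class numbers, are never cleared. Instead the counter
  \<open>fresh\<close> of class numbers is never reset: a stale value of \<open>new\<close> lies
  below \<open>base\<close>, and a stale entry of \<open>seen\<close> sits at an index below all
  current class numbers. The price is that \<open>fresh\<close> may grow to the order of n (n + m)
  over the 2 n refinements, which is why words of size quadratic in n + m are used. Deletion
  likewise leaves the adjacency lists untouched. The array \<open>rep\<close> sends each original
  vertex to the survivor that carries its weight, so an equation between two survivors can be
  written at once as a row over the original vertices. Which kind of twins is present is not known
  in advance; every round therefore tries false twins and then true twins. It may delete two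
  vertices, and rounds run idle once a single vertex is left.\<close>

primrec wvars :: "com \<Rightarrow> string set" where
  "wvars Skip = {}"
| "wvars (Assign x e) = {x}"
| "wvars (Write a i e) = {}"
| "wvars (Seq c d) = wvars c \<union> wvars d"
| "wvars (Cond b c d) = wvars c \<union> wvars d"
| "wvars (While b c) = wvars c"

primrec warrs :: "com \<Rightarrow> string set" where
  "warrs Skip = {}"
| "warrs (Assign x e) = {}"
| "warrs (Write a i e) = {a}"
| "warrs (Seq c d) = warrs c \<union> warrs d"
| "warrs (Cond b c d) = warrs c \<union> warrs d"
| "warrs (While b c) = warrs c"

definition frame :: "string set \<Rightarrow> string set \<Rightarrow> state \<Rightarrow> state \<Rightarrow> bool" where
  "frame X A s s' \<longleftrightarrow> (\<forall>x. x \<notin> X \<longrightarrow> var s' x = var s x) \<and> (\<forall>a. a \<notin> A \<longrightarrow> arr s' a = arr s a)"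

lemma frame_refl: "frame X A s s"
  by (simp add: frame_def)

lemma frame_trans: "frame X A s s' \<Longrightarrow> frame X A s' s'' \<Longrightarrow> frame X A s s''"
  by (simp add: frame_def)

lemma frame_mono: "frame X A s s' \<Longrightarrow> X \<subseteq> X' \<Longrightarrow> A \<subseteq> A' \<Longrightarrow> frame X' A' s s'"
  by (auto simp: frame_def)

lemma exec_frame: "exec W c s t s' \<Longrightarrow> frame (wvars c) (warrs c) s s'"
  by (induction rule: exec.induct) (auto simp: frame_def)

text \<open>Commands are deterministic, so one halting execution amounts to total correctness. The
  time is only bounded above, which lets bounds be rounded up and branches be padded to a common
  cost.\<close>

definition runs :: "nat \<Rightarrow> com \<Rightarrow> state \<Rightarrow> nat \<Rightarrow> (state \<Rightarrow> bool) \<Rightarrow> bool" where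
  "runs W c s T Q \<longleftrightarrow> (\<exists>t s'. exec W c s t s' \<and> t \<le> T \<and> Q s')"

lemma runs_mono:
  assumes "runs W c s T Q" "T \<le> T'" "\<And>s'. Q s' \<Longrightarrow> frame (wvars c) (warrs c) s s' \<Longrightarrow> Q' s'"
  shows "runs W c s T' Q'"
  using assms exec_frame unfolding runs_def by (meson order_trans)

text \<open>The frame of \<open>c\<close> is handed to the proof about \<open>d\<close>, so the
  intermediate assertion \<open>R\<close> has to mention only what \<open>c\<close> changes.\<close>

lemma runs_Seq:
  assumes "runs W c s T1 R"
    and "\<And>s'. R s' \<Longrightarrow> frame (wvars c) (warrs c) s s' \<Longrightarrow> runs W d s' T2 Q"
    and "T1 + T2 \<le> T"
  shows "runs W (Seq c d) s T Q"
proof -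
  obtain t s' where 1: "exec W c s t s'" "t \<le> T1" "R s'"
    using assms(1) by (auto simp: runs_def)
  then obtain t' s'' where 2: "exec W d s' t' s''" "t' \<le> T2" "Q s''"
    using assms(2) exec_frame by (metis runs_def)
  have "exec W (Seq c d) s (t + t') s''"
    using 1 2 by (blast intro: exec.Seq)
  moreover have "t + t' \<le> T"
    using 1 2 assms(3) by linarith
  ultimately show ?thesis
    using 2 unfolding runs_def by blast
qed

lemma runs_Cond:
  assumes "bsafe W b s"
    and "bval b s \<Longrightarrow> runs W c s T1 Q"
    and "\<not> bval b s \<Longrightarrow> runs W d s T1 Q"
    and "bcost b + T1 + 1 \<le> T"
  shows "runs W (Cond b c d) s T Q"
proof (cases "bval b s")
  case True
  then obtain t s' where 1: "exec W c s t s'" "t \<le> T1" "Q s'"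
    using assms(2) by (auto simp: runs_def)
  have "exec W (Cond b c d) s (bcost b + t + 1) s'"
    using 1 True assms(1) by (blast intro: exec.CondTrue)
  moreover have "bcost b + t + 1 \<le> T"
    using 1 assms(4) by linarith
  ultimately show ?thesis
    using 1 unfolding runs_def by blast
next
  case False
  then obtain t s' where 1: "exec W d s t s'" "t \<le> T1" "Q s'"
    using assms(3) by (auto simp: runs_def)
  have "exec W (Cond b c d) s (bcost b + t + 1) s'"
    using 1 False assms(1) by (blast intro: exec.CondFalse)
  moreover have "bcost b + t + 1 \<le> T"
    using 1 assms(4) by linarith
  ultimately show ?thesis
    using 1 unfolding runs_def by blast
qed

text \<open>\<open>k\<close> counts completed iterations and \<open>N\<close> is their exact number.
  The bound \<open>T k\<close> may vary with \<open>k\<close>, so that a loop over adjacency rows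
  can be charged by the degree of each row.\<close>

lemma runs_While:
  assumes "I 0 s"
    and "\<And>k s'. k < N \<Longrightarrow> I k s' \<Longrightarrow> frame (wvars c) (warrs c) s s' \<Longrightarrow>
      bsafe W b s' \<and> bval b s' \<and> runs W c s' (T k) (I (Suc k))"
    and "\<And>s'. I N s' \<Longrightarrow> frame (wvars c) (warrs c) s s' \<Longrightarrow> bsafe W b s' \<and> \<not> bval b s'"
  shows "runs W (While b c) s ((\<Sum>k<N. T k + bcost b + 1) + bcost b + 1) (I N)"
proof -
  \<comment> \<open>Generalised to a start after \<open>k\<close> iterations; the induction is on
    the number \<open>N - k\<close> of those left.\<close>
  have "runs W (While b c) s' ((\<Sum>j=k..<N. T j + bcost b + 1) + bcost b + 1) (I N)"
    if "k \<le> N" "I k s'" "frame (wvars c) (warrs c) s s'" for k s'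
    using that
  proof (induction "N - k" arbitrary: k s')
    case 0
    then have "k = N" by simp
    then have "exec W (While b c) s' (bcost b + 1) s'"
      using 0 assms(3)[of s'] by (blast intro: exec.WhileFalse)
    then show ?case
      using 0 \<open>k = N\<close> unfolding runs_def by force
  next
    case (Suc d)
    then have "k < N" by simp
    then have b: "bsafe W b s'" "bval b s'" and "runs W c s' (T k) (I (Suc k))"
      using assms(2)[of k s'] Suc by auto
    then obtain t u where 1: "exec W c s' t u" "t \<le> T k" "I (Suc k) u"
      by (auto simp: runs_def)
    have "frame (wvars c) (warrs c) s u"
      using Suc.prems(3) exec_frame[OF 1(1)] frame_trans by blast
    then have "runs W (While b c) u ((\<Sum>j=Suc k..<N. T j + bcost b + 1) + bcost b + 1) (I N)"
      using Suc.hyps(1)[of "Suc k" u] Suc.hyps(2) \<open>k < N\<close> 1(3) by simp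
    then obtain t' u' where 2: "exec W (While b c) u t' u'"
      "t' \<le> (\<Sum>j=Suc k..<N. T j + bcost b + 1) + bcost b + 1" "I N u'"
      by (auto simp: runs_def)
    have "exec W (While b c) s' (bcost b + t + t' + 1) u'"
      using b 1 2 by (blast intro: exec.WhileTrue)
    moreover have "bcost b + t + t' + 1 \<le> (\<Sum>j=k..<N. T j + bcost b + 1) + bcost b + 1"
      using 1(2) 2(2) by (subst sum.atLeast_Suc_lessThan[OF \<open>k < N\<close>]) linarith
    ultimately show ?case
      using 2 unfolding runs_def by blast
  qed
  from this[of 0 s] show ?thesis
    using assms(1) frame_refl by (simp add: atLeast0LessThan)
qed

section \<open>Symbolic execution of loop-free programs, and counted loops\<close>

primrec final :: "com \<Rightarrow> state \<Rightarrow> state" where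
  "final Skip s = s"
| "final (Assign x e) s = s\<lparr>var := (var s)(x := aval e s)\<rparr>"
| "final (Write a i e) s = s\<lparr>arr := (arr s)(a := (arr s a)(nat (aval i s) := aval e s))\<rparr>"
| "final (Seq c d) s = final d (final c s)"
| "final (Cond b c d) s = (if bval b s then final c s else final d s)"
| "final (While b c) s = s"

primrec csafe :: "nat \<Rightarrow> com \<Rightarrow> state \<Rightarrow> bool" where
  "csafe W Skip s \<longleftrightarrow> True"
| "csafe W (Assign x e) s \<longleftrightarrow> asafe W e s"
| "csafe W (Write a i e) s \<longleftrightarrow> asafe W i s \<and> 0 \<le> aval i s \<and> asafe W e s"
| "csafe W (Seq c d) s \<longleftrightarrow> csafe W c s \<and> csafe W d (final c s)"
| "csafe W (Cond b c d) s \<longleftrightarrow> bsafe W b s \<and> (if bval b s then csafe W c s else csafe W d s)"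
| "csafe W (While b c) s \<longleftrightarrow> False"

primrec ccost :: "com \<Rightarrow> nat" where
  "ccost Skip = 1"
| "ccost (Assign x e) = acost e + 1"
| "ccost (Write a i e) = acost i + acost e + 1"
| "ccost (Seq c d) = ccost c + ccost d"
| "ccost (Cond b c d) = bcost b + max (ccost c) (ccost d) + 1"
| "ccost (While b c) = 0"

text \<open>Loop-free programs (\<open>csafe\<close> fails on loops) are executed symbolically.\<close>

lemma runs_loop_free:
  assumes "csafe W c s" "ccost c \<le> T" "Q (final c s)"
  shows "runs W c s T Q"
proof -
  have "runs W c s (ccost c) (\<lambda>s'. s' = final c s)"
    using assms(1)
  proof (induction c arbitrary: s)
    case (Seq c1 c2)
    then show ?case
      by (force intro: runs_Seq[where ?T2.0 = "ccost c2"])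
  next
    case (Cond b c1 c2)
    show ?case
      by (rule runs_Cond[where ?T1.0 = "max (ccost c1) (ccost c2)"])
        (use Cond in \<open>auto intro!: runs_mono[OF Cond.IH(1)] runs_mono[OF Cond.IH(2)] split: if_splits\<close>)
  next
    case Skip
    show ?case
      unfolding runs_def using exec.Skip by force
  next
    case (Assign x e)
    then show ?case
      unfolding runs_def using exec.Assign by force
  next
    case (Write a i e)
    then show ?case
      unfolding runs_def using exec.Write by force
  qed simp
  then show ?thesis
    using assms(2,3) by (auto intro: runs_mono)
qed

definition For :: "string \<Rightarrow> com \<Rightarrow> com" where
  "For x c = Seq (Assign x (Const 0))
     (While (Less (Var x) (Var ''n'')) (Seq c (Assign x (Plus (Var x) (Const 1)))))"

lemma wvars_For [simp]: "wvars (For x c) = insert x (wvars c)"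
  and warrs_For [simp]: "warrs (For x c) = warrs c"
  by (auto simp: For_def)

text \<open>\<open>indep\<close> lets the counter be reset and incremented without disturbing the
  invariant. The 8 consists of the increment (4), the test (3) and the loop step (1); the 6 of the
  initialisation (2) and the last, failing test (4).\<close>

lemma runs_For:
  assumes x: "x \<notin> wvars c" "''n'' \<notin> wvars c" "x \<noteq> ''n''"
    and N: "var s ''n'' = int N" "N < W"
    and indep: "\<And>k s' v. I k (s'\<lparr>var := (var s')(x := v)\<rparr>) = I k s'"
    and "I 0 s"
    and step: "\<And>k s'. k < N \<Longrightarrow> I k s' \<Longrightarrow> var s' x = int k \<Longrightarrow>
      frame (insert x (wvars c)) (warrs c) s s' \<Longrightarrow> runs W c s' (T k) (I (Suc k))"
    and T': "(\<Sum>k<N. T k + 8) + 6 \<le> T'"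
  shows "runs W (For x c) s T' (I N)"
  unfolding For_def
proof (rule runs_Seq[where R = "\<lambda>s'. I 0 s' \<and> var s' x = 0" and ?T1.0 = 2
      and ?T2.0 = "(\<Sum>k<N. T k + 4 + 3 + 1) + 3 + 1"])
  show "runs W (Assign x (Const 0)) s 2 (\<lambda>s'. I 0 s' \<and> var s' x = 0)"
    by (rule runs_loop_free) (use indep assms(7) in auto)
next
  let ?b = "Less (Var x) (Var ''n'')"
  let ?c = "Seq c (Assign x (Plus (Var x) (Const 1)))"
  fix s0
  assume s0: "I 0 s0 \<and> var s0 x = 0"
    "frame (wvars (Assign x (Const 0))) (warrs (Assign x (Const 0))) s s0"
  have "runs W (While ?b ?c) s0 ((\<Sum>k<N. T k + 4 + bcost ?b + 1) + bcost ?b + 1)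
    (\<lambda>s'. I N s' \<and> var s' x = int N)"
  proof (rule runs_While[where I = "\<lambda>k s'. I k s' \<and> var s' x = int k"])
    fix k s'
    assume k: "k < N" "I k s' \<and> var s' x = int k" "frame (wvars ?c) (warrs ?c) s0 s'"
    have fr: "frame (insert x (wvars c)) (warrs c) s s'"
      using s0(2) k(3) by (auto simp: frame_def)
    then have n: "var s' ''n'' = int N"
      using N x by (auto simp: frame_def)
    have "runs W ?c s' (T k + 4) (\<lambda>s'. I (Suc k) s' \<and> var s' x = int (Suc k))"
    proof (rule runs_Seq)
      show "runs W c s' (T k) (I (Suc k))"
        using step k fr by auto
      fix u
      assume "I (Suc k) u" "frame (wvars c) (warrs c) s' u"
      then show "runs W (Assign x (Plus (Var x) (Const 1))) u 4
          (\<lambda>s'. I (Suc k) s' \<and> var s' x = int (Suc k))"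
        using k N x by (intro runs_loop_free) (auto simp: indep frame_def)
    qed simp
    then show "bsafe W ?b s' \<and> bval ?b s' \<and>
        runs W ?c s' (T k + 4) (\<lambda>s'. I (Suc k) s' \<and> var s' x = int (Suc k))"
      using n k N by auto
  next
    fix s'
    assume k: "I N s' \<and> var s' x = int N" "frame (wvars ?c) (warrs ?c) s0 s'"
    have "frame (insert x (wvars c)) (warrs c) s s'"
      using s0(2) k(2) by (auto simp: frame_def)
    then have n: "var s' ''n'' = int N"
      using N x by (auto simp: frame_def)
    then show "bsafe W ?b s' \<and> \<not> bval ?b s'"
      using k N by auto
  qed (use s0 in auto)
  then show "runs W (While ?b ?c) s0 ((\<Sum>k<N. T k + 4 + 3 + 1) + 3 + 1) (I N)"
    by (rule runs_mono) auto
next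
  show "2 + ((\<Sum>k<N. T k + 4 + 3 + 1) + 3 + 1) \<le> T'"
    using T' by (simp add: sum.distrib)
qed

section \<open>Twins and well-covered weightings\<close>

text \<open>Adjacency is a relation kept apart from the vertex set, so deleting a vertex shrinks
  only the set. The same notions then serve for graph vertices and for vertex numbers.\<close>

definition adj_rel :: "('a \<Rightarrow> 'a \<Rightarrow> bool) \<Rightarrow> 'a set \<Rightarrow> bool" where
  "adj_rel E V \<longleftrightarrow> finite V \<and> (\<forall>u\<in>V. \<not> E u u) \<and> (\<forall>u\<in>V. \<forall>v\<in>V. E u v \<longrightarrow> E v u)"

text \<open>Maximality appears as domination: every vertex left out has a neighbour inside. This can
  be checked one vertex at a time, without comparison to larger sets.\<close>

definition mis :: "('a \<Rightarrow> 'a \<Rightarrow> bool) \<Rightarrow> 'a set \<Rightarrow> 'a set \<Rightarrow> bool" where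
  "mis E A I \<longleftrightarrow> I \<subseteq> A \<and> (\<forall>u\<in>I. \<forall>v\<in>I. \<not> E u v) \<and> (\<forall>x\<in>A - I. \<exists>u\<in>I. E x u)"

definition wcw :: "('a \<Rightarrow> 'a \<Rightarrow> bool) \<Rightarrow> 'a set \<Rightarrow> ('a \<Rightarrow> real) \<Rightarrow> bool" where
  "wcw E A w \<longleftrightarrow> (\<forall>I J. mis E A I \<and> mis E A J \<longrightarrow> sum w I = sum w J)"

lemma wcwD: "wcw E A w \<Longrightarrow> mis E A I \<Longrightarrow> mis E A J \<Longrightarrow> sum w I = sum w J"
  unfolding wcw_def by blast

text \<open>\<open>q\<close> selects true twins (equal closed neighbourhoods) or false twins (equal open ones).\<close>

definition twins :: "bool \<Rightarrow> ('a \<Rightarrow> 'a \<Rightarrow> bool) \<Rightarrow> 'a set \<Rightarrow> 'a \<Rightarrow> 'a \<Rightarrow> bool" where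
  "twins q E A u v \<longleftrightarrow> u \<in> A \<and> v \<in> A \<and> u \<noteq> v \<and>
     (\<forall>x\<in>A. E x u \<or> (q \<and> x = u) \<longleftrightarrow> E x v \<or> (q \<and> x = v))"

lemma adj_relD:
  assumes "adj_rel E V"
  shows "finite V" "x \<in> V \<Longrightarrow> \<not> E x x" "x \<in> V \<Longrightarrow> y \<in> V \<Longrightarrow> E x y \<longleftrightarrow> E y x"
  using assms unfolding adj_rel_def by blast+

lemma adj_rel_subset: "adj_rel E V \<Longrightarrow> A \<subseteq> V \<Longrightarrow> adj_rel E A"
  unfolding adj_rel_def by (meson finite_subset subset_iff)

text \<open>Supplies a maximal independent set through one of two true twins; exchanging the twins
  in it yields the equation between their weights.\<close>

lemma mis_extend:
  assumes "adj_rel E A" "u \<in> A"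
  shows "\<exists>I. mis E A I \<and> u \<in> I"
proof -
  let ?F = "{I. I \<subseteq> A \<and> (\<forall>x\<in>I. \<forall>y\<in>I. \<not> E x y)}"
  note E = adj_relD[OF assms(1)]
  have "finite ?F"
    by (rule finite_subset[of _ "Pow A"]) (use E(1) in auto)
  moreover have "{u} \<in> ?F"
    using E(2) assms(2) by auto
  ultimately have "\<exists>I\<in>?F. {u} \<subseteq> I \<and> (\<forall>J\<in>?F. I \<subseteq> J \<longrightarrow> I = J)"
    by (rule finite_has_maximal2)
  then obtain I where I: "I \<in> ?F" "{u} \<subseteq> I" and max: "\<forall>J\<in>?F. I \<subseteq> J \<longrightarrow> I = J"
    by (elim bexE conjE)
  have "\<exists>y\<in>I. E x y" if x: "x \<in> A - I" for x
  proof (rule ccontr)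
    assume "\<not> (\<exists>y\<in>I. E x y)"
    then have "insert x I \<in> ?F"
      using I x E(2,3) by blast
    then show False
      using max x by blast
  qed
  then show ?thesis
    using I unfolding mis_def by blast
qed

text \<open>Removing \<open>v\<close> sends the maximal independent sets of \<open>A\<close> onto
  those of \<open>A - {v}\<close> and turns the weight \<open>w\<close> into the merged weight.
  \<open>down\<close> gives this map and its effect on weights, \<open>up\<close> its
  surjectivity.\<close>

lemma false_twins_wcw:
  assumes E: "adj_rel E A" and t: "twins False E A u v"
  shows "wcw E A w \<longleftrightarrow> wcw E (A - {v}) (w(u := w u + w v))"
proof -
  let ?w = "w(u := w u + w v)"
  have sym: "E x y \<longleftrightarrow> E y x" if "x \<in> A" "y \<in> A" for x y
    using adj_relD(3)[OF E that] .
  have uv: "u \<in> A" "v \<in> A" "u \<noteq> v" "\<And>x. x \<in> A \<Longrightarrow> E x u \<longleftrightarrow> E x v"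
    and irr: "\<not> E u u" "\<not> E v v"
    using t adj_relD(2)[OF E] by (auto simp: twins_def)
  have fin: "finite I" if "mis E B I" "B \<subseteq> A" for I B
    using that E by (meson adj_rel_def finite_subset mis_def)
  have both: "u \<in> I \<longleftrightarrow> v \<in> I" if "mis E A I" for I
  proof -
    have I: "I \<subseteq> A" "\<And>x y. x \<in> I \<Longrightarrow> y \<in> I \<Longrightarrow> \<not> E x y"
      "\<And>x. x \<in> A \<Longrightarrow> x \<notin> I \<Longrightarrow> \<exists>y\<in>I. E x y"
      using that by (auto simp: mis_def)
    \<comment> \<open>Thus a neighbour in \<open>I\<close> that keeps one twin out of
      \<open>I\<close> also keeps out the other.\<close>
    have "E u y \<longleftrightarrow> E v y" if "y \<in> I" for y
      using that I(1) uv sym by blast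
    then show ?thesis
      using I uv(1,2) by blast
  qed
  have down: "mis E (A - {v}) (I - {v})" "sum ?w (I - {v}) = sum w I" if I: "mis E A I" for I
  proof -
    show "mis E (A - {v}) (I - {v})"
      unfolding mis_def
    proof (intro conjI ballI)
      fix x
      assume x: "x \<in> A - {v} - (I - {v})"
      then obtain y where y: "y \<in> I" "E x y"
        using I unfolding mis_def by blast
      show "\<exists>y\<in>I - {v}. E x y"
      proof (cases "y = v")
        case True
        then show ?thesis
          using x y uv both[OF I] by auto
      qed (use y in auto)
    qed (use I in \<open>auto simp: mis_def\<close>)
    show "sum ?w (I - {v}) = sum w I"
    proof (cases "v \<in> I")
      case True
      then have "sum ?w (I - {v}) = ?w u + sum ?w (I - {v} - {u})"
        using both[OF I] uv fin[OF I] by (intro sum.remove) auto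
      moreover have "sum ?w (I - {v} - {u}) = sum w (I - {v} - {u})"
        by (intro sum.cong) auto
      moreover have "sum w I = w v + (w u + sum w (I - {v} - {u}))"
        using both[OF I] uv fin[OF I] True
        by (subst sum.remove[of I v], simp, simp, subst sum.remove[of "I - {v}" u]) auto
      ultimately show ?thesis
        by simp
    next
      case False
      then show ?thesis
        using both[OF I] by (auto intro: sum.cong)
    qed
  qed
  have up: "\<exists>I. mis E A I \<and> I - {v} = J" if J: "mis E (A - {v}) J" for J
  \<comment> \<open>If \<open>u\<close> is in \<open>J\<close>, then \<open>v\<close> can be added.
    Otherwise a neighbour of \<open>u\<close> in \<open>J\<close> is also one of \<open>v\<close>,
    and \<open>J\<close> is already maximal in \<open>A\<close>.\<close>
  proof (cases "u \<in> J")
    case True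
    have "mis E A (insert v J)"
      unfolding mis_def
    proof (intro conjI ballI)
      show "insert v J \<subseteq> A"
        using J uv by (auto simp: mis_def)
      fix x y
      assume "x \<in> insert v J" "y \<in> insert v J"
      moreover have "\<not> E x u" "\<not> E u x" if "x \<in> J" for x
        using J True that by (auto simp: mis_def)
      then have "\<not> E x v" "\<not> E v x" if "x \<in> J" for x
        using J that uv(2) uv(4)[of x] sym[of x v] by (auto simp: mis_def)
      ultimately show "\<not> E x y"
        using J irr by (auto simp: mis_def)
    next
      fix x
      assume "x \<in> A - insert v J"
      then show "\<exists>y\<in>insert v J. E x y"
        using J by (auto simp: mis_def)
    qed
    moreover have "insert v J - {v} = J"
      using J by (auto simp: mis_def)
    ultimately show ?thesis
      by blast
  next
    case False
    then obtain y where y: "y \<in> J" "E u y"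
      using J uv unfolding mis_def by blast
    moreover have "y \<in> A"
      using J y by (auto simp: mis_def)
    ultimately have "E v y"
      using uv sym by blast
    then have "mis E A J"
      using J y unfolding mis_def by blast
    then show ?thesis
      using J by (auto simp: mis_def)
  qed
  show ?thesis
  proof
    assume wc: "wcw E A w"
    show "wcw E (A - {v}) ?w"
      unfolding wcw_def
    proof (intro allI impI, elim conjE)
      fix I J
      assume "mis E (A - {v}) I" "mis E (A - {v}) J"
      then obtain I' J' where "mis E A I'" "I' - {v} = I" "mis E A J'" "J' - {v} = J"
        using up by blast
      then show "sum ?w I = sum ?w J"
        using down(2)[of I'] down(2)[of J'] wcwD[OF wc, of I' J'] by simp
    qed
  next
    assume wc: "wcw E (A - {v}) ?w"
    show "wcw E A w"
      unfolding wcw_def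
    proof (intro allI impI, elim conjE)
      fix I J
      assume "mis E A I" "mis E A J"
      then show "sum w I = sum w J"
        using down[of I] down[of J] wcwD[OF wc, of "I - {v}" "J - {v}"] by simp
    qed
  qed
qed

text \<open>A maximal independent set of \<open>A - {v}\<close> stays maximal in \<open>A\<close>,
  because it contains \<open>u\<close> or a neighbour of \<open>u\<close>, and either dominates
  \<open>v\<close>. A set containing \<open>v\<close> is traded for one containing \<open>u\<close>,
  which has the same weight exactly when \<open>w u = w v\<close>.\<close>

lemma true_twins_wcw:
  assumes E: "adj_rel E A" and t: "twins True E A u v"
  shows "wcw E A w \<longleftrightarrow> w u = w v \<and> wcw E (A - {v}) w"
proof -
  have sym: "E x y \<longleftrightarrow> E y x" if "x \<in> A" "y \<in> A" for x y
    using adj_relD(3)[OF E that] .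
  have uv: "u \<in> A" "v \<in> A" "u \<noteq> v" "\<And>x. x \<in> A \<Longrightarrow> x \<noteq> u \<Longrightarrow> x \<noteq> v \<Longrightarrow> E x u \<longleftrightarrow> E x v"
    and adj: "E u v" "E v u" and irr: "\<And>x. x \<in> A \<Longrightarrow> \<not> E x x"
    using t adj_relD(2)[OF E] by (auto simp: twins_def)
  have fin: "finite I" if "I \<subseteq> A" for I
    using that E by (meson adj_rel_def finite_subset)
  have up: "mis E A J" if J: "mis E (A - {v}) J" for J
  proof -
    have "\<exists>y\<in>J. E v y"
    proof (cases "u \<in> J")
      case False
      then obtain y where y: "y \<in> J" "E u y"
        using J uv unfolding mis_def by blast
      moreover from y have "y \<in> A" "y \<noteq> u" "y \<noteq> v"
        using J False by (auto simp: mis_def)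
      ultimately have "E v y"
        using uv(1,2,4) sym by blast
      with y show ?thesis
        by blast
    qed (use adj in auto)
    then show ?thesis
      using J unfolding mis_def by blast
  qed
  have down: "mis E (A - {v}) I" if "mis E A I" "v \<notin> I" for I
    using that unfolding mis_def by blast
  have swap: "mis E A (insert b (I - {a}))"
    if I: "mis E A I" "a \<in> I" and ab: "a = u \<and> b = v \<or> a = v \<and> b = u" for I a b
  proof -
    have ab': "a \<in> A" "b \<in> A" "a \<noteq> b" "E a b" "E b a" "\<And>x. x \<in> A \<Longrightarrow> x \<noteq> a \<Longrightarrow> x \<noteq> b \<Longrightarrow> E x a \<longleftrightarrow> E x b"
      using ab uv adj by auto
    have b: "b \<notin> I"
      using I ab' by (auto simp: mis_def)
    have 1: "insert b (I - {a}) \<subseteq> A"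
      using I ab' by (auto simp: mis_def)
    have nb: "\<not> E x b" "\<not> E b x" if "x \<in> I - {a}" for x
      using that I ab'(2) ab'(6)[of x] b sym[of x b] unfolding mis_def by blast+
    have 2: "\<not> E x y" if "x \<in> insert b (I - {a})" "y \<in> insert b (I - {a})" for x y
      using that nb irr[OF ab'(2)] I by (auto simp: mis_def)
    have 3: "\<exists>y\<in>insert b (I - {a}). E x y" if x: "x \<in> A - insert b (I - {a})" for x
    proof (cases "x = a")
      case False
      then obtain y where y: "y \<in> I" "E x y"
        using I x unfolding mis_def by blast
      then show ?thesis
        using False x ab'(6)[of x] by (cases "y = a") auto
    qed (use ab' in auto)
    show ?thesis
      unfolding mis_def using 1 2 3 by blast
  qed
  have swap_sum: "sum w (insert b (I - {a})) + w a = sum w I + w b"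
    if I: "mis E A I" "a \<in> I" and ab: "a = u \<and> b = v \<or> a = v \<and> b = u" for I a b
  proof -
    have "b \<notin> I"
      using I ab adj unfolding mis_def by blast
    moreover have "finite I"
      using I fin by (auto simp: mis_def)
    ultimately show ?thesis
      using I(2) by (simp add: sum.remove[of I a])
  qed
  show ?thesis
  proof
    assume wc: "wcw E A w"
    obtain I where I: "mis E A I" "u \<in> I"
      using mis_extend[OF E uv(1)] by blast
    have "w u = w v"
    proof -
      have "sum w (insert v (I - {u})) = sum w I"
        using wcwD[OF wc swap[OF I, of v] I(1)] by simp
      then show ?thesis
        using swap_sum[OF I, of v] by simp
    qed
    moreover have "wcw E (A - {v}) w"
      using wc up unfolding wcw_def by blast
    ultimately show "w u = w v \<and> wcw E (A - {v}) w"
      by blast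
  next
    assume h: "w u = w v \<and> wcw E (A - {v}) w"
    have "\<exists>J. mis E (A - {v}) J \<and> sum w J = sum w I" if I: "mis E A I" for I
    proof (cases "v \<in> I")
      case True
      have "mis E (A - {v}) (insert u (I - {v}))"
        using swap[OF I True, of u] down uv by auto
      then show ?thesis
        using swap_sum[OF I True, of u] h by auto
    qed (use I down in blast)
    note J = this
    show "wcw E A w"
      unfolding wcw_def
    proof (intro allI impI, elim conjE)
      fix I I'
      assume "mis E A I" "mis E A I'"
      then obtain J J' where "mis E (A - {v}) J" "sum w J = sum w I"
        "mis E (A - {v}) J'" "sum w J' = sum w I'"
        using J by meson
      then show "sum w I = sum w I'"
        using wcwD[OF conjunct2[OF h], of J J'] by simp
    qed
  qed
qed

lemma wcw_singleton: "\<not> E a a \<Longrightarrow> wcw E {a} w"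
proof -
  assume "\<not> E a a"
  then have "mis E {a} I \<longleftrightarrow> I = {a}" for I
    by (auto simp: mis_def)
  then show ?thesis
    by (simp add: wcw_def)
qed

lemma wcw_cong:
  assumes "\<And>x. x \<in> A \<Longrightarrow> w x = w' x"
  shows "wcw E A w \<longleftrightarrow> wcw E A w'"
proof -
  have "sum w I = sum w' I" if "mis E A I" for I
    using that assms by (intro sum.cong) (auto simp: mis_def)
  then show ?thesis
    unfolding wcw_def by metis
qed

section \<open>Twins in vertex subsets of cographs\<close>

lemma cograph_edges_subset: "cograph G \<Longrightarrow> e \<in> edges G \<Longrightarrow> e \<subseteq> verts G"
  by (induction arbitrary: e rule: cograph.induct) (auto simp: graph_union_def graph_complement_def)

text \<open>Rules out n = 0, where a time bound proportional to n (n + m) would be 0 although every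
  execution takes at least one step.\<close>

lemma cograph_nonempty: "cograph G \<Longrightarrow> verts G \<noteq> {}"
  by (induction rule: cograph.induct) (auto simp: graph_union_def graph_complement_def)

text \<open>Quantifying over all vertex subsets makes the claim survive deletions. In a union, a
  side that meets \<open>A\<close> at least twice supplies the pair, since the other side is
  adjacent to neither vertex; if both sides meet \<open>A\<close> at most once, then
  \<open>A\<close> is the pair itself. Complementation flips both adjacencies to a third vertex.
  Whether \<open>u\<close> and \<open>v\<close> are adjacent is left open, so both kinds of twins
  are treated at once.\<close>

lemma cograph_has_twins:
  assumes "cograph G" "A \<subseteq> verts G" "finite A" "2 \<le> card A"
  shows "\<exists>u\<in>A. \<exists>v\<in>A. u \<noteq> v \<and> (\<forall>x\<in>A - {u, v}. {u, x} \<in> edges G \<longleftrightarrow> {v, x} \<in> edges G)"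
  using assms
proof (induction arbitrary: A rule: cograph.induct)
  case (single v)
  then have "card A \<le> 1"
    by (simp add: subset_singleton_iff) auto
  then show ?case
    using single by simp
next
  case (disjoint_union G H)
  let ?P = "\<lambda>K B u v. u \<in> B \<and> v \<in> B \<and> u \<noteq> v \<and>
    (\<forall>x\<in>B - {u, v}. {u, x} \<in> edges K \<longleftrightarrow> {v, x} \<in> edges K)"
  have disj: "verts G \<inter> verts H = {}" by fact
  have G: "a \<in> verts G" "b \<in> verts G" if "{a, b} \<in> edges G" for a b
    using cograph_edges_subset[OF disjoint_union.hyps(1) that] by auto
  have H: "a \<in> verts H" "b \<in> verts H" if "{a, b} \<in> edges H" for a b
    using cograph_edges_subset[OF disjoint_union.hyps(2) that] by auto
  have A: "A = (A \<inter> verts G) \<union> (A \<inter> verts H)"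
    using disjoint_union.prems by (auto simp: graph_union_def)
  consider "2 \<le> card (A \<inter> verts G)" | "2 \<le> card (A \<inter> verts H)"
    | "card (A \<inter> verts G) \<le> 1" "card (A \<inter> verts H) \<le> 1"
    by linarith
  then show ?case
  proof cases
    case 1
    then obtain u v where "?P G (A \<inter> verts G) u v"
      using disjoint_union.IH(1)[of "A \<inter> verts G"] disjoint_union.prems by auto
    then have uv: "u \<in> A" "v \<in> A" "u \<in> verts G" "v \<in> verts G" "u \<noteq> v"
      "\<And>x. x \<in> A \<Longrightarrow> x \<in> verts G \<Longrightarrow> x \<noteq> u \<Longrightarrow> x \<noteq> v \<Longrightarrow> {u, x} \<in> edges G \<longleftrightarrow> {v, x} \<in> edges G"
      by auto
    have "{u, x} \<in> edges (graph_union G H) \<longleftrightarrow> {v, x} \<in> edges (graph_union G H)"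
      if "x \<in> A" "x \<noteq> u" "x \<noteq> v" for x
      using that uv(3,4) uv(6)[of x] G[of u x] G[of v x] H[of u x] H[of v x] disj
      by (cases "x \<in> verts G") (auto simp: graph_union_def disjoint_iff)
    then have "?P (graph_union G H) A u v"
      using uv by blast
    then show ?thesis by blast
  next
    case 2
    then obtain u v where "?P H (A \<inter> verts H) u v"
      using disjoint_union.IH(2)[of "A \<inter> verts H"] disjoint_union.prems by auto
    then have uv: "u \<in> A" "v \<in> A" "u \<in> verts H" "v \<in> verts H" "u \<noteq> v"
      "\<And>x. x \<in> A \<Longrightarrow> x \<in> verts H \<Longrightarrow> x \<noteq> u \<Longrightarrow> x \<noteq> v \<Longrightarrow> {u, x} \<in> edges H \<longleftrightarrow> {v, x} \<in> edges H"
      by auto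
    have "{u, x} \<in> edges (graph_union G H) \<longleftrightarrow> {v, x} \<in> edges (graph_union G H)"
      if "x \<in> A" "x \<noteq> u" "x \<noteq> v" for x
      using that uv(3,4) uv(6)[of x] G[of u x] G[of v x] H[of u x] H[of v x] disj
      by (cases "x \<in> verts H") (auto simp: graph_union_def disjoint_iff)
    then have "?P (graph_union G H) A u v"
      using uv by blast
    then show ?thesis by blast
  next
    case 3
    have "card A \<le> card (A \<inter> verts G) + card (A \<inter> verts H)"
      by (subst A) (rule card_Un_le)
    then have "card A = 2"
      using 3 disjoint_union.prems by linarith
    then obtain u v where "A = {u, v}" "u \<noteq> v"
      by (auto simp: card_2_iff)
    then show ?thesis by auto
  qed
next
  case (complement G)
  have A: "A \<subseteq> verts G"
    using complement.prems by (simp add: graph_complement_def)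
  obtain u v where uv: "u \<in> A" "v \<in> A" "u \<noteq> v"
    "\<forall>x\<in>A - {u, v}. {u, x} \<in> edges G \<longleftrightarrow> {v, x} \<in> edges G"
    using complement.IH[OF A complement.prems(2,3)] by blast
  have c: "{a, x} \<in> edges (graph_complement G) \<longleftrightarrow> {a, x} \<notin> edges G"
    if "a \<in> A" "x \<in> A" "a \<noteq> x" for a x
    using that A by (auto simp: graph_complement_def doubleton_eq_iff insert_commute)
  have "\<forall>x\<in>A - {u, v}. {u, x} \<in> edges (graph_complement G) \<longleftrightarrow> {v, x} \<in> edges (graph_complement G)"
    using uv by (auto simp: c)
  then show ?case
    using uv by blast
qed

section \<open>Invariants of the algorithm\<close>

abbreviation adj_in :: "nat list list \<Rightarrow> nat \<Rightarrow> nat \<Rightarrow> bool" where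
  "adj_in L i j \<equiv> j \<in> set (L ! i)"

definition alive :: "nat \<Rightarrow> (nat \<Rightarrow> int) \<Rightarrow> nat set" where
  "alive n rep = {v. v < n \<and> rep v = int v}"

definition group_weight :: "nat \<Rightarrow> (nat \<Rightarrow> int) \<Rightarrow> (nat \<Rightarrow> real) \<Rightarrow> nat \<Rightarrow> real" where
  "group_weight n rep w u = (\<Sum>j | j < n \<and> rep j = int u. w j)"

text \<open>
  The invariant of the algorithm: \<open>rep j\<close> is the surviving vertex whose weight includes that
  of \<open>j\<close>, or \<open>n\<close> if \<open>j\<close> no longer contributes.
\<close>

definition reduced :: "nat \<Rightarrow> (nat \<Rightarrow> nat \<Rightarrow> bool) \<Rightarrow> (nat \<Rightarrow> int) \<Rightarrow> nat \<Rightarrow> (nat \<Rightarrow> int) \<Rightarrow> bool" where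
  "reduced n E rep m coeff \<longleftrightarrow>
     (\<forall>j<n. rep j = int n \<or> (\<exists>u\<in>alive n rep. rep j = int u)) \<and>
     alive n rep \<noteq> {} \<and> m + card (alive n rep) \<le> n \<and>
     (\<forall>w. wcw E {..<n} w \<longleftrightarrow>
        (\<forall>i<m. (\<Sum>j<n. of_int (coeff (i * n + j)) * w j) = 0) \<and>
        wcw E (alive n rep) (group_weight n rep w))"

lemma alive_subset: "alive n rep \<subseteq> {..<n}"
  by (auto simp: alive_def)

lemma finite_alive [simp]: "finite (alive n rep)"
  using alive_subset finite_subset by blast

text \<open>Redirecting the group of \<open>v\<close> to \<open>u\<close> adds the two group
  weights, which is the change of weight prescribed by \<open>false_twins_wcw\<close>. No row is
  written.\<close>

lemma reduced_false_twins:
  assumes red: "reduced n E rep m coeff" and E: "adj_rel E {..<n}"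
    and t: "twins False E (alive n rep) u v"
    and rep': "\<And>j. j < n \<Longrightarrow> rep' j = (if rep j = int v then int u else rep j)"
  shows "reduced n E rep' m coeff" "alive n rep' = alive n rep - {v}"
proof -
  have uv: "u \<in> alive n rep" "v \<in> alive n rep" "u \<noteq> v"
    using t by (auto simp: twins_def)
  show al: "alive n rep' = alive n rep - {v}"
  proof (intro set_eqI)
    fix j
    show "j \<in> alive n rep' \<longleftrightarrow> j \<in> alive n rep - {v}"
      using uv rep'[of j] by (auto simp: alive_def)
  qed
  have "group_weight n rep' w x =
      ((group_weight n rep w)(u := group_weight n rep w u + group_weight n rep w v)) x"
    if "x \<in> alive n rep'" for w x
  proof (cases "x = u")
    case True
    have "rep' j = int u \<longleftrightarrow> rep j = int u \<or> rep j = int v" if "j < n" for j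
      using rep'[OF that] uv by auto
    then have eq: "{j. j < n \<and> rep' j = int u} =
        {j. j < n \<and> rep j = int u} \<union> {j. j < n \<and> rep j = int v}"
      by blast
    have "group_weight n rep' w u = group_weight n rep w u + group_weight n rep w v"
      unfolding group_weight_def eq by (rule sum.union_disjoint) (use uv(3) in auto)
    then show ?thesis
      using True by simp
  next
    case False
    have "rep' j = int x \<longleftrightarrow> rep j = int x" if "j < n" for j
      using rep'[OF that] False \<open>x \<in> alive n rep'\<close> al by auto
    then have "{j. j < n \<and> rep' j = int x} = {j. j < n \<and> rep j = int x}"
      by blast
    then show ?thesis
      using False by (simp add: group_weight_def)
  qed
  note gw = this
  have wc: "wcw E (alive n rep') (group_weight n rep' w) \<longleftrightarrow>
      wcw E (alive n rep) (group_weight n rep w)" for w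
    unfolding false_twins_wcw[OF adj_rel_subset[OF E alive_subset] t] al[symmetric]
    by (rule wcw_cong) (rule gw)
  have "card (alive n rep') < card (alive n rep)"
    unfolding al using uv by (intro psubset_card_mono) auto
  moreover have "rep' j = int n \<or> (\<exists>u\<in>alive n rep'. rep' j = int u)" if "j < n" for j
    using red that uv unfolding reduced_def al rep'[OF that] by auto
  moreover have "alive n rep' \<noteq> {}"
    using al uv by blast
  ultimately show "reduced n E rep' m coeff"
    using red unfolding reduced_def wc by auto
qed

text \<open>The new row is the indicator of the group of \<open>u\<close> minus that of
  \<open>v\<close>, so it evaluates to the difference of the two group weights. Each row is paid for
  by one survivor, which preserves \<open>m + card (alive n rep) \<le> n\<close>.\<close>

lemma reduced_true_twins:
  assumes red: "reduced n E rep m coeff" and E: "adj_rel E {..<n}"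
    and t: "twins True E (alive n rep) u v"
    and rep': "\<And>j. j < n \<Longrightarrow> rep' j = (if rep j = int v then int n else rep j)"
    and coeff': "\<And>k. k < m * n \<Longrightarrow> coeff' k = coeff k"
      "\<And>j. j < n \<Longrightarrow> coeff' (m * n + j) =
        (if rep j = int u then 1 else if rep j = int v then - 1 else 0)"
  shows "reduced n E rep' (Suc m) coeff'" "alive n rep' = alive n rep - {v}"
proof -
  have uv: "u \<in> alive n rep" "v \<in> alive n rep" "u \<noteq> v"
    using t by (auto simp: twins_def)
  show al: "alive n rep' = alive n rep - {v}"
  proof (intro set_eqI)
    fix j
    show "j \<in> alive n rep' \<longleftrightarrow> j \<in> alive n rep - {v}"
      using uv rep'[of j] by (auto simp: alive_def)
  qed
  have "group_weight n rep' w x = group_weight n rep w x" if "x \<in> alive n rep'" for w x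
  proof -
    \<comment> \<open>Survivors are below \<open>n\<close>, so a vertex sent to \<open>n\<close>
      enters no surviving group.\<close>
    have "rep' j = int x \<longleftrightarrow> rep j = int x" if "j < n" for j
      using rep'[OF that] \<open>x \<in> alive n rep'\<close> al alive_subset[of n rep] by auto
    then have "{j. j < n \<and> rep' j = int x} = {j. j < n \<and> rep j = int x}"
      by blast
    then show ?thesis
      by (simp add: group_weight_def)
  qed
  note gw = this
  have 1: "wcw E (alive n rep') (group_weight n rep' w) \<longleftrightarrow>
      wcw E (alive n rep - {v}) (group_weight n rep w)" for w
    unfolding al[symmetric] by (rule wcw_cong) (rule gw)
  have row: "(\<Sum>j<n. of_int (coeff' (m * n + j)) * w j) =
      group_weight n rep w u - group_weight n rep w v" for w :: "nat \<Rightarrow> real"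
  proof -
    have "(\<Sum>j<n. of_int (coeff' (m * n + j)) * w j) =
        (\<Sum>j<n. (if rep j = int u then w j else 0) - (if rep j = int v then w j else 0))"
      using coeff'(2) uv by (intro sum.cong) auto
    also have "\<dots> = group_weight n rep w u - group_weight n rep w v"
      by (simp add: group_weight_def sum_subtractf sum.If_cases Collect_conj_eq lessThan_def)
    finally show ?thesis .
  qed
  have old: "(\<Sum>j<n. of_int (coeff' (i * n + j)) * w j) = (\<Sum>j<n. of_int (coeff (i * n + j)) * w j)"
    if "i < m" for i and w :: "nat \<Rightarrow> real"
  proof (intro sum.cong refl)
    fix j
    assume "j \<in> {..<n}"
    \<comment> \<open>Entries of earlier rows lie below \<open>m * n\<close>, where
      \<open>coeff'\<close> agrees with \<open>coeff\<close>.\<close>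
    then have "i * n + j < Suc i * n"
      by simp
    also have "\<dots> \<le> m * n"
      using that by (intro mult_le_mono1) simp
    finally show "of_int (coeff' (i * n + j)) * w j = of_int (coeff (i * n + j)) * w j"
      by (simp add: coeff'(1))
  qed
  have "(\<forall>i<Suc m. (\<Sum>j<n. of_int (coeff' (i * n + j)) * w j) = 0) \<and>
        wcw E (alive n rep') (group_weight n rep' w) \<longleftrightarrow>
      (\<forall>i<m. (\<Sum>j<n. of_int (coeff (i * n + j)) * w j) = 0) \<and>
        wcw E (alive n rep) (group_weight n rep w)" for w
    unfolding true_twins_wcw[OF adj_rel_subset[OF E alive_subset] t] 1
    using old by (auto simp: less_Suc_eq row)
  moreover have "card (alive n rep') < card (alive n rep)"
    unfolding al using uv by (intro psubset_card_mono) auto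
  moreover have "rep' j = int n \<or> (\<exists>u\<in>alive n rep'. rep' j = int u)" if "j < n" for j
    using red that uv unfolding reduced_def al rep'[OF that] by auto
  moreover have "alive n rep' \<noteq> {}"
    using al uv by blast
  ultimately show "reduced n E rep' (Suc m) coeff'"
    using red unfolding reduced_def by auto
qed

lemma reduced_initial:
  assumes "0 < n" "\<And>j. j < n \<Longrightarrow> rep j = int j"
  shows "reduced n E rep 0 coeff" "alive n rep = {..<n}"
proof -
  show al: "alive n rep = {..<n}"
    using assms by (auto simp: alive_def)
  have "group_weight n rep w x = w x" if "x < n" for w x
  proof -
    have "{j. j < n \<and> rep j = int x} = {x}"
      using assms that by auto
    then show ?thesis
      by (simp add: group_weight_def)
  qed
  then have "wcw E {..<n} (group_weight n rep w) \<longleftrightarrow> wcw E {..<n} w" for w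
    by (intro wcw_cong) auto
  then show "reduced n E rep 0 coeff"
    using assms by (auto simp: reduced_def al)
qed

text \<open>
  A pass over a row has split the classes \<open>cls0\<close> by the set \<open>Y\<close>. Class numbers issued in this pass
  are at least \<open>b\<close>, and \<open>new k\<close> is such a number iff class \<open>k\<close> has already met \<open>Y\<close>. Since the counter
  \<open>f\<close> of class numbers is never reset, entries left by earlier passes are smaller than \<open>b\<close>.
\<close>

definition splits ::
  "nat \<Rightarrow> int \<Rightarrow> (nat \<Rightarrow> int) \<Rightarrow> nat set \<Rightarrow> (nat \<Rightarrow> int) \<Rightarrow> (nat \<Rightarrow> int) \<Rightarrow> int \<Rightarrow> bool" where
  "splits n b cls0 Y cls new f \<longleftrightarrow>
     (\<forall>v<n. cls v = (if v \<in> Y then new (nat (cls0 v)) else cls0 v)) \<and>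
     (\<forall>v<n. 0 \<le> cls0 v \<and> cls0 v < b) \<and>
     (\<forall>v\<in>Y. b \<le> new (nat (cls0 v))) \<and>
     (\<forall>k. 0 \<le> new k \<and> new k < f) \<and> b \<le> f \<and>
     (\<forall>k k'. b \<le> new k \<and> new k = new k' \<longrightarrow> k = k')"

lemma splits_insert_old:
  assumes "splits n b cls0 Y cls new f" "y < n" "y \<notin> Y" "b \<le> new (nat (cls y))"
  shows "splits n b cls0 (insert y Y) (cls(y := new (nat (cls y)))) new f"
  using assms unfolding splits_def by auto

text \<open>\<open>y\<close> is the first vertex of its class met in this pass: an earlier one in
  \<open>Y\<close> would have put a number of at least \<open>b\<close> into the entry. Hence
  overwriting that entry affects no vertex of \<open>Y\<close>, and since \<open>f\<close> exceeds
  every entry of \<open>new\<close>, injectivity from \<open>b\<close> on is kept.\<close>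

lemma splits_insert_new:
  assumes "splits n b cls0 Y cls new f" "y < n" "y \<notin> Y" "new (nat (cls y)) < b"
  shows "splits n b cls0 (insert y Y) (cls(y := f)) (new(nat (cls y) := f)) (f + 1)"
proof -
  have y: "cls y = cls0 y"
    using assms by (auto simp: splits_def)
  have ne: "nat (cls0 v) \<noteq> nat (cls0 y)" if "v \<in> Y" for v
  proof -
    have "b \<le> new (nat (cls0 v))"
      using assms(1) that by (auto simp: splits_def)
    then show ?thesis
      using assms(4) y by auto
  qed
  have bounds: "0 \<le> new k" "new k < f" "new k \<noteq> f" "b \<le> f" for k
    using assms(1) unfolding splits_def by (metis less_irrefl)+
  then have "0 \<le> f"
    by (meson less_imp_le order_trans)
  then show ?thesis
    using assms(1-3) ne bounds unfolding splits_def y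
    by (auto simp: less_imp_le add_increasing2 zless_add1_eq)
qed

section \<open>Refinement row by row, and the search for two vertices in one class\<close>

definition nbhd :: "nat list list \<Rightarrow> bool \<Rightarrow> nat \<Rightarrow> nat set" where
  "nbhd L q x = set (L ! x) \<union> (if q then {x} else {})"

text \<open>Deleted vertices are classified too, because they still occur in the rows; only rows of
  \<open>A\<close> count as separators. The bound \<open>f0\<close> places all current class numbers
  beyond those of earlier refinements, so old table entries cannot interfere.\<close>

definition refined ::
  "nat list list \<Rightarrow> bool \<Rightarrow> nat set \<Rightarrow> nat \<Rightarrow> int \<Rightarrow> (nat \<Rightarrow> int) \<Rightarrow> (nat \<Rightarrow> int) \<Rightarrow> int \<Rightarrow> bool" where
  "refined L q A x f0 cls new f \<longleftrightarrow> 0 \<le> f0 \<and> f0 \<le> f \<and>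
     (\<forall>v<length L. f0 \<le> cls v \<and> cls v < f) \<and> (\<forall>k. 0 \<le> new k \<and> new k < f) \<and>
     (\<forall>u<length L. \<forall>v<length L. cls u = cls v \<longleftrightarrow>
        (\<forall>z<x. z \<in> A \<longrightarrow> (u \<in> nbhd L q z \<longleftrightarrow> v \<in> nbhd L q z)))"

lemma refinedD:
  assumes "refined L q A x f0 cls new f"
  shows "0 \<le> f0" "f0 \<le> f" "v < length L \<Longrightarrow> f0 \<le> cls v" "v < length L \<Longrightarrow> cls v < f"
    "0 \<le> new k" "new k < f"
    "u < length L \<Longrightarrow> v < length L \<Longrightarrow>
      cls u = cls v \<longleftrightarrow> (\<forall>z<x. z \<in> A \<longrightarrow> (u \<in> nbhd L q z \<longleftrightarrow> v \<in> nbhd L q z))"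
  using assms unfolding refined_def by blast+

lemma refined_splits:
  assumes "refined L q A x f0 cls new f"
  shows "splits (length L) f cls {} cls new f"
proof -
  note R = refinedD(1-6)[OF assms]
  have "0 \<le> cls v" if "v < length L" for v
    using R(1) R(3)[OF that] by linarith
  then show ?thesis
    using R unfolding splits_def by (auto simp: not_le[symmetric])
qed

text \<open>Vertices in the neighbourhood of \<open>x\<close> receive numbers from \<open>b\<close>
  on that depend injectively on the old class, and the others keep numbers below \<open>b\<close>.
  So two vertices agree afterwards exactly if they agreed before and lie on the same side of the
  row.\<close>

lemma refined_step:
  assumes R: "refined L q A x f0 cls0 new0 b" and S: "splits (length L) b cls0 (nbhd L q x) cls new f"
    and x: "x \<in> A"
  shows "refined L q A (Suc x) f0 cls new f"
proof -
  have cls0: "f0 \<le> cls0 v" "0 \<le> cls0 v" "cls0 v < b" if "v < length L" for v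
    using refinedD(1)[OF R] refinedD(3,4)[OF R that] by linarith+
  have f: "f0 \<le> b" "b \<le> f"
    using refinedD(2)[OF R] S by (auto simp: splits_def)
  have cls: "cls v = (if v \<in> nbhd L q x then new (nat (cls0 v)) else cls0 v)" if "v < length L" for v
    using S that by (auto simp: splits_def)
  have new: "b \<le> new (nat (cls0 v))" if "v \<in> nbhd L q x" for v
    using S that by (auto simp: splits_def)
  have inj: "k = k'" if "b \<le> new k" "new k = new k'" for k k'
    using S that by (auto simp: splits_def)
  have newf: "0 \<le> new k \<and> new k < f" for k
    using S by (auto simp: splits_def)
  have "cls u = cls v \<longleftrightarrow> cls0 u = cls0 v \<and> (u \<in> nbhd L q x \<longleftrightarrow> v \<in> nbhd L q x)"
    if uv: "u < length L" "v < length L" for u v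
  proof (cases "u \<in> nbhd L q x"; cases "v \<in> nbhd L q x")
    assume "u \<in> nbhd L q x" "v \<in> nbhd L q x"
    then show ?thesis
      using cls[OF uv(1)] cls[OF uv(2)] new[of u] inj[of "nat (cls0 u)" "nat (cls0 v)"]
        cls0[OF uv(1)] cls0[OF uv(2)] by auto
  next
    assume "u \<in> nbhd L q x" "v \<notin> nbhd L q x"
    then show ?thesis
      using cls[OF uv(1)] cls[OF uv(2)] new[of u] cls0[OF uv(2)] by auto
  next
    assume "u \<notin> nbhd L q x" "v \<in> nbhd L q x"
    then show ?thesis
      using cls[OF uv(1)] cls[OF uv(2)] new[of v] cls0[OF uv(1)] by auto
  next
    assume "u \<notin> nbhd L q x" "v \<notin> nbhd L q x"
    then show ?thesis
      using cls[OF uv(1)] cls[OF uv(2)] by auto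
  qed
  note eq = this
  have "f0 \<le> cls v \<and> cls v < f" if "v < length L" for v
    using cls[OF that] new[of v] newf[of "nat (cls0 v)"] cls0[OF that] f by auto
  moreover have "cls u = cls v \<longleftrightarrow>
      (\<forall>z<Suc x. z \<in> A \<longrightarrow> (u \<in> nbhd L q z \<longleftrightarrow> v \<in> nbhd L q z))"
    if "u < length L" "v < length L" for u v
    unfolding eq[OF that] refinedD(7)[OF R that] using x less_Suc_eq by auto
  ultimately show ?thesis
    unfolding refined_def using refinedD(1)[OF R] f newf by (meson order_trans)
qed

lemma refined_skip:
  "refined L q A x f0 cls new f \<Longrightarrow> x \<notin> A \<Longrightarrow> refined L q A (Suc x) f0 cls new f"
  unfolding refined_def less_Suc_eq by metis

text \<open>\<open>twins\<close> asks of each \<open>x\<close> in \<open>A\<close> whether row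
  \<open>x\<close> treats \<open>u\<close> and \<open>v\<close> alike, which is what agreement after
  all rows of \<open>A\<close> expresses.\<close>

lemma refined_twins:
  assumes "refined L q A (length L) f0 cls new f" "A \<subseteq> {..<length L}" "u \<in> A" "v \<in> A" "u \<noteq> v"
  shows "cls u = cls v \<longleftrightarrow> twins q (adj_in L) A u v"
proof -
  have "u < length L" "v < length L" "\<forall>z\<in>A. z < length L"
    using assms(2-4) by auto
  then show ?thesis
    using assms(3-5) refinedD(7)[OF assms(1), of u v] unfolding twins_def nbhd_def by auto
qed

text \<open>
  \<open>seen k\<close> is \<open>u + 1\<close> for the first vertex \<open>u\<close> met in class \<open>k\<close>, and \<open>0\<close> if there is none. Entries
  for classes below \<open>f0\<close> stem from earlier rounds.
\<close>

definition searched ::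
  "nat \<Rightarrow> nat set \<Rightarrow> nat \<Rightarrow> int \<Rightarrow> int \<Rightarrow> (nat \<Rightarrow> int) \<Rightarrow> (nat \<Rightarrow> int) \<Rightarrow> int \<Rightarrow> int \<Rightarrow> int \<Rightarrow> bool" where
  "searched n A x f0 f cls seen found pu pv \<longleftrightarrow>
     (\<forall>k. 0 \<le> seen k \<and> seen k \<le> int n) \<and>
     (\<forall>k. f \<le> int k \<longrightarrow> seen k = 0) \<and>
     (\<forall>k. f0 \<le> int k \<and> seen k \<noteq> 0 \<longrightarrow>
        (\<exists>u\<in>A. u < x \<and> seen k = int u + 1 \<and> cls u = int k)) \<and>
     (\<forall>v\<in>A. v < x \<longrightarrow> seen (nat (cls v)) \<noteq> 0) \<and>
     (if found = 0 then inj_on cls {v\<in>A. v < x}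
      else found = 1 \<and> (\<exists>u\<in>A. \<exists>v\<in>A. u \<noteq> v \<and> cls u = cls v \<and> pu = int u \<and> pv = int v))"

lemma searched_skip: "searched n A x f0 f cls seen found pu pv \<Longrightarrow> x \<notin> A \<Longrightarrow>
  searched n A (Suc x) f0 f cls seen found pu pv"
proof -
  assume s: "searched n A x f0 f cls seen found pu pv" and x: "x \<notin> A"
  then have "{v\<in>A. v < Suc x} = {v\<in>A. v < x}"
    by (auto simp: less_Suc_eq)
  then show ?thesis
    using s x unfolding searched_def by (auto simp: less_Suc_eq)
qed

lemma searched_new:
  assumes s: "searched n A x f0 f cls seen found pu pv" and x: "x \<in> A" "x < n"
    and cls: "0 \<le> f0" "f0 \<le> cls x" "cls x < f" and new: "seen (nat (cls x)) = 0"
  shows "searched n A (Suc x) f0 f cls (seen(nat (cls x) := int x + 1)) found pu pv"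
proof -
  have "inj_on cls {v\<in>A. v < Suc x}" if "inj_on cls {v\<in>A. v < x}"
  proof -
    have "{v\<in>A. v < Suc x} = insert x {v\<in>A. v < x}"
      using x by (auto simp: less_Suc_eq)
    moreover have "cls x \<notin> cls ` {v\<in>A. v < x}"
      using s new by (auto simp: searched_def)
    ultimately show ?thesis
      using that by simp
  qed
  moreover have "\<exists>u\<in>A. u < Suc x \<and> (seen(nat (cls x) := int x + 1)) k = int u + 1 \<and> cls u = int k"
    if "f0 \<le> int k" "(seen(nat (cls x) := int x + 1)) k \<noteq> 0" for k
  proof (cases "k = nat (cls x)")
    case True
    then show ?thesis
      using x cls by (intro bexI[of _ x]) auto
  next
    case False
    then show ?thesis
      using s that unfolding searched_def by (auto simp: less_Suc_eq)
  qed
  ultimately show ?thesis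
    using s x cls unfolding searched_def by (auto simp: less_Suc_eq)
qed

text \<open>The vertex recorded for the class was met before \<open>x\<close> and so differs from
  it.\<close>

lemma searched_old:
  assumes s: "searched n A x f0 f cls seen found pu pv" and x: "x \<in> A"
    and cls: "0 \<le> f0" "f0 \<le> cls x" and old: "seen (nat (cls x)) \<noteq> 0"
  shows "searched n A (Suc x) f0 f cls seen 1 (seen (nat (cls x)) - 1) (int x)"
proof -
  have k: "int (nat (cls x)) = cls x"
    using cls by simp
  have "\<forall>k. f0 \<le> int k \<and> seen k \<noteq> 0 \<longrightarrow> (\<exists>u\<in>A. u < x \<and> seen k = int u + 1 \<and> cls u = int k)"
    using s unfolding searched_def by (elim conjE)
  from this[rule_format, of "nat (cls x)"] obtain u
    where u: "u \<in> A" "u < x" "seen (nat (cls x)) = int u + 1" "cls u = cls x"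
    using cls(2) old unfolding k by blast
  have "\<exists>u\<in>A. \<exists>v\<in>A. u \<noteq> v \<and> cls u = cls v \<and> seen (nat (cls x)) - 1 = int u \<and> int x = int v"
    using u x by (intro bexI[of _ u] bexI[of _ x]) auto
  then show ?thesis
    using s old unfolding searched_def by (auto simp: less_Suc_eq)
qed

section \<open>The program and its verification\<close>

definition split_vertex :: com where
  "split_vertex = Seq
     (Cond (Less (Read ''new'' (Read ''cls'' (Var ''y''))) (Var ''base''))
       (Seq (Write ''new'' (Read ''cls'' (Var ''y'')) (Var ''fresh''))
            (Assign ''fresh'' (Plus (Var ''fresh'') (Const 1))))
       Skip)
     (Write ''cls'' (Var ''y'') (Read ''new'' (Read ''cls'' (Var ''y''))))"

definition split_neighbours :: com where
  "split_neighbours = While (Less (Var ''p'') (Read ''start'' (Plus (Var ''x'') (Const 1))))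
     (Seq (Assign ''y'' (Read ''adj'' (Var ''p'')))
       (Seq split_vertex (Assign ''p'' (Plus (Var ''p'') (Const 1)))))"

text \<open>\<open>q\<close> is fixed when the program text is built, so the two kinds of twins get
  two copies of the code.\<close>

definition split_row :: "bool \<Rightarrow> com" where
  "split_row q = Cond (Equal (Read ''rep'' (Var ''x'')) (Var ''x''))
     (Seq (Assign ''base'' (Var ''fresh''))
       (Seq (if q then Seq (Assign ''y'' (Var ''x'')) split_vertex else Skip)
         (Seq (Assign ''p'' (Read ''start'' (Var ''x''))) split_neighbours)))
     Skip"

definition refine :: "bool \<Rightarrow> com" where
  "refine q = Seq (For ''x'' (Write ''cls'' (Var ''x'') (Var ''fresh'')))
     (Seq (Assign ''fresh'' (Plus (Var ''fresh'') (Const 1))) (For ''x'' (split_row q)))"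

text \<open>A later collision overwrites an earlier pair, which is harmless because any pair in one
  class will do.\<close>

definition search_step :: com where
  "search_step = Cond (Equal (Read ''rep'' (Var ''x'')) (Var ''x''))
     (Cond (Equal (Read ''seen'' (Read ''cls'' (Var ''x''))) (Const 0))
       (Write ''seen'' (Read ''cls'' (Var ''x'')) (Plus (Var ''x'') (Const 1)))
       (Seq (Assign ''found'' (Const 1))
         (Seq (Assign ''pu'' (Minus (Read ''seen'' (Read ''cls'' (Var ''x''))) (Const 1)))
           (Assign ''pv'' (Var ''x'')))))
     Skip"

definition search :: com where
  "search = Seq (Assign ''found'' (Const 0)) (For ''x'' search_step)"

definition merge_false :: com where
  "merge_false = For ''j'' (Cond (Equal (Read ''rep'' (Var ''j'')) (Var ''pv''))
     (Write ''rep'' (Var ''j'') (Var ''pu'')) Skip)"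

abbreviation coeff_index :: aexp where
  "coeff_index \<equiv> Plus (Times (Var ''size'') (Var ''n'')) (Var ''j'')"

definition merge_true :: com where
  "merge_true = Seq
     (For ''j'' (Cond (Equal (Read ''rep'' (Var ''j'')) (Var ''pu''))
       (Write ''coeff'' coeff_index (Const 1))
       (Cond (Equal (Read ''rep'' (Var ''j'')) (Var ''pv''))
         (Seq (Write ''coeff'' coeff_index (Const (- 1))) (Write ''rep'' (Var ''j'') (Var ''n'')))
         (Write ''coeff'' coeff_index (Const 0)))))
     (Assign ''size'' (Plus (Var ''size'') (Const 1)))"

definition round_com :: "bool \<Rightarrow> com" where
  "round_com q = Seq (refine q) (Seq search
     (Cond (Equal (Var ''found'') (Const 1)) (if q then merge_true else merge_false) Skip))"

text \<open>Starting \<open>fresh\<close> at 1 puts the zero entries of \<open>new\<close> below it,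
  so neither table has to be initialised. The index \<open>i\<close> only counts rounds; n of them
  suffice, as each deletes a vertex while two are left.\<close>

definition program :: com where
  "program = Seq (For ''x'' (Write ''rep'' (Var ''x'') (Var ''x'')))
     (Seq (Assign ''fresh'' (Const 1)) (For ''i'' (Seq (round_com False) (round_com True))))"

lemma split_vertex_frame [simp]:
  "wvars split_vertex = {''fresh''}" "warrs split_vertex = {''new'', ''cls''}"
  by (auto simp: split_vertex_def)

lemma split_neighbours_frame [simp]:
  "wvars split_neighbours = {''y'', ''fresh'', ''p''}" "warrs split_neighbours = {''new'', ''cls''}"
  by (auto simp: split_neighbours_def)

lemma split_row_frame [simp]:
  "wvars (split_row q) = {''base'', ''y'', ''fresh'', ''p''}" "warrs (split_row q) = {''new'', ''cls''}"
  by (auto simp: split_row_def)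

lemma refine_frame [simp]:
  "wvars (refine q) = {''x'', ''base'', ''y'', ''fresh'', ''p''}" "warrs (refine q) = {''new'', ''cls''}"
  by (auto simp: refine_def)

lemma search_frame [simp]:
  "wvars search_step = {''found'', ''pu'', ''pv''}" "warrs search_step = {''seen''}"
  "wvars search = {''x'', ''found'', ''pu'', ''pv''}" "warrs search = {''seen''}"
  by (auto simp: search_step_def search_def)

lemma merge_frame [simp]:
  "wvars merge_false = {''j''}" "warrs merge_false = {''rep''}"
  "wvars merge_true = {''j'', ''size''}" "warrs merge_true = {''coeff'', ''rep''}"
  by (auto simp: merge_false_def merge_true_def)

lemma round_com_frame [simp]:
  "''n'' \<notin> wvars (round_com q)" "''i'' \<notin> wvars (round_com q)"
  "''start'' \<notin> warrs (round_com q)" "''adj'' \<notin> warrs (round_com q)"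
  by (cases q; simp add: round_com_def)+

lemma runs_split_vertex:
  assumes S: "splits n b cls0 Y (arr s ''cls'') (arr s ''new'') (var s ''fresh'')"
    and y: "y < n" "y \<notin> Y" "var s ''y'' = int y" and b: "var s ''base'' = b"
    and W: "var s ''fresh'' < int W" "n \<le> W"
  shows "runs W split_vertex s 19 (\<lambda>s'.
    splits n b cls0 (insert y Y) (arr s' ''cls'') (arr s' ''new'') (var s' ''fresh'') \<and>
    var s ''fresh'' \<le> var s' ''fresh'' \<and> var s' ''fresh'' \<le> var s ''fresh'' + 1)"
proof -
  let ?c = "arr s ''cls'' y"
  have c: "0 \<le> ?c" "?c < b"
    using S y by (auto simp: splits_def)
  have new: "0 \<le> arr s ''new'' k" "arr s ''new'' k < var s ''fresh''" for k
    using S by (auto simp: splits_def)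
  have bf: "b \<le> var s ''fresh''"
    using S by (auto simp: splits_def)
  have bd: "\<bar>?c\<bar> \<le> int W" "arr s ''new'' k \<le> int W" "\<bar>b\<bar> \<le> int W" "\<bar>var s ''fresh''\<bar> \<le> int W"
    "\<bar>var s ''fresh'' + 1\<bar> \<le> int W" "int y \<le> int W" "1 \<le> int W" for k
    using c bf W y new[of k] by linarith+
  show ?thesis
  proof (rule runs_loop_free)
    show "csafe W split_vertex s"
      using c bd y b new(1) by (simp add: split_vertex_def)
    \<comment> \<open>14 for the conditional with its longer branch, and 5 for the write to
      \<open>cls\<close>.\<close>
    show "ccost split_vertex \<le> 19"
      by (simp add: split_vertex_def)
    show "splits n b cls0 (insert y Y) (arr (final split_vertex s) ''cls'')
        (arr (final split_vertex s) ''new'') (var (final split_vertex s) ''fresh'') \<and>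
      var s ''fresh'' \<le> var (final split_vertex s) ''fresh'' \<and>
      var (final split_vertex s) ''fresh'' \<le> var s ''fresh'' + 1"
    proof (cases "arr s ''new'' (nat ?c) < b")
      case True
      then show ?thesis
        using splits_insert_new[OF S y(1,2)] y b by (simp add: split_vertex_def)
    next
      case False
      then show ?thesis
        using splits_insert_old[OF S y(1,2)] y b by (simp add: split_vertex_def)
    qed
  qed
qed

text \<open>The left side is 11 n + 6 to initialise \<open>rep\<close>, 2 to set
  \<open>fresh\<close>, and the main loop with 228 (n + M + 1) + 8 per round and 6 overhead. As n +
  M + 1 is at least 2, the lower terms fit into 22 n (n + M + 1).\<close>

lemma total_time:
  fixes n M :: nat
  assumes "0 < n"
  shows "11 * n + 6 + (n * (228 * (n + M + 1) + 8) + 8) \<le> 250 * (n * (n + M + 1))"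
proof -
  have "n * (228 * (n + M + 1) + 8) = 228 * (n * (n + M + 1)) + 8 * n"
    by (simp add: algebra_simps)
  moreover have "n * 2 \<le> n * (n + M + 1)"
    using assms by (intro mult_le_mono2) simp
  ultimately show ?thesis
    using assms by linarith
qed

text \<open>In \<open>word\<close>, the square bounds the addresses of coefficients. The second
  summand bounds the numbers drawn from \<open>fresh\<close>, since each of the 2 n refinements
  draws at most 1 + n + M of them. The rest covers pointers into the lists and small
  constants.\<close>

locale machine_input =
  fixes L :: "nat list list" and W :: nat
  assumes row: "i < length L \<Longrightarrow> distinct (L ! i) \<and> set (L ! i) \<subseteq> {..<length L} \<and> i \<notin> set (L ! i)"
    and row_sym: "i < length L \<Longrightarrow> j \<in> set (L ! i) \<Longrightarrow> i \<in> set (L ! j)"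
    and word: "length L * length L + 2 * length L * (length L + length (concat L) + 1) +
      length (concat L) + length L + 10 \<le> W"
begin

abbreviation "n \<equiv> length L"
abbreviation "M \<equiv> length (concat L)"

definition input_ok :: "state \<Rightarrow> bool" where
  "input_ok s \<longleftrightarrow> var s ''n'' = int n \<and>
     (\<forall>k\<le>n. arr s ''start'' k = int (length (concat (take k L)))) \<and>
     (\<forall>k<M. arr s ''adj'' k = int (concat L ! k))"

lemma input_ok_frame:
  "input_ok s \<Longrightarrow> frame X A s s' \<Longrightarrow> ''n'' \<notin> X \<Longrightarrow> ''start'' \<notin> A \<Longrightarrow> ''adj'' \<notin> A \<Longrightarrow> input_ok s'"
  by (simp add: input_ok_def frame_def)

lemma word_bounds: "n < W" "M < W" "10 \<le> W" "n * n + n < W" "n + M + 10 \<le> W"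
  using word by auto

lemma start_Suc: "x < n \<Longrightarrow> length (concat (take (Suc x) L)) = length (concat (take x L)) + length (L ! x)"
  by (simp add: take_Suc_conv_app_nth)

lemma start_le: "length (concat (take x L)) \<le> M"
  by (metis append_take_drop_id concat_append le_add1 length_append)

lemma concat_nth:
  assumes "x < n" "k < length (L ! x)"
  shows "length (concat (take x L)) + k < M" "concat L ! (length (concat (take x L)) + k) = L ! x ! k"
proof -
  have "concat L = concat (take x L) @ L ! x @ concat (drop (Suc x) L)"
    using assms(1) by (metis concat.simps(2) concat_append id_take_nth_drop)
  then show "length (concat (take x L)) + k < M" "concat L ! (length (concat (take x L)) + k) = L ! x ! k"
    using assms(2) by (simp_all add: nth_append)
qed

lemma sum_degrees: "(\<Sum>x<k. length (L ! x)) \<le> M" if "k \<le> n"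
proof -
  have "(\<Sum>x<k. length (L ! x)) = length (concat (take k L))"
    using that by (induction k) (auto simp: take_Suc_conv_app_nth)
  then show ?thesis
    using start_le by simp
qed

text \<open>\<open>Y\<close> is the part of the neighbourhood already handled, namely
  \<open>{x}\<close> for closed neighbourhoods. Its disjointness from the row and the absence of
  repetitions in the row ensure that each vertex is still in its old class when it is split.\<close>

lemma runs_split_neighbours:
  assumes S: "splits n b cls0 Y (arr s ''cls'') (arr s ''new'') (var s ''fresh'')"
    and x: "x < n" "var s ''x'' = int x" "Y \<inter> set (L ! x) = {}"
    and s: "input_ok s" "var s ''base'' = b" "var s ''p'' = int (length (concat (take x L)))"
    and f: "var s ''fresh'' + int (length (L ! x)) \<le> int W"
  shows "runs W split_neighbours s (33 * length (L ! x) + 7) (\<lambda>s'.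
    splits n b cls0 (Y \<union> set (L ! x)) (arr s' ''cls'') (arr s' ''new'') (var s' ''fresh'') \<and>
    var s' ''fresh'' \<le> var s ''fresh'' + int (length (L ! x)))"
proof -
  let ?o = "length (concat (take x L))"
  let ?r = "L ! x"
  let ?b = "Less (Var ''p'') (Read ''start'' (Plus (Var ''x'') (Const 1)))"
  let ?c = "Seq (Assign ''y'' (Read ''adj'' (Var ''p'')))
       (Seq split_vertex (Assign ''p'' (Plus (Var ''p'') (Const 1))))"
  let ?I = "\<lambda>k s'. splits n b cls0 (Y \<union> set (take k ?r)) (arr s' ''cls'') (arr s' ''new'') (var s' ''fresh'') \<and>
    var s' ''p'' = int (?o + k) \<and> var s' ''fresh'' \<le> var s ''fresh'' + int k"
  \<comment> \<open>\<open>start\<close> has an entry beyond the last vertex, so the end of every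
    row can be read as the start of the next.\<close>
  have start: "arr s ''start'' (Suc x) = int (?o + length ?r)"
    using s(1) x(1) start_Suc[OF x(1)] by (simp add: input_ok_def)
  have bounds: "?o + length ?r \<le> M"
    using start_le[of "Suc x"] start_Suc[OF x(1)] by simp
  \<comment> \<open>An iteration costs 26 + 6 + 1 = 33, where the body takes 3 + 19 + 4; the failing
    test at the end costs 7.\<close>
  have "runs W (While ?b ?c) s ((\<Sum>k<length ?r. 26 + bcost ?b + 1) + bcost ?b + 1) (?I (length ?r))"
  proof (rule runs_While)
    show "?I 0 s"
      using S s by simp
  next
    fix k s'
    assume k: "k < length ?r" and I: "?I k s'" and "frame (wvars ?c) (warrs ?c) s s'"
    then have fr: "frame {''y'', ''fresh'', ''p''} {''new'', ''cls''} s s'"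
      by (auto intro: frame_mono)
    have s': "var s' ''x'' = int x" "var s' ''base'' = b"
      "arr s' ''start'' = arr s ''start''" "arr s' ''adj'' = arr s ''adj''"
      using fr x s by (auto simp: frame_def)
    let ?y = "?r ! k"
    have y: "?y < n" "?y \<notin> Y \<union> set (take k ?r)"
    proof -
      show "?y < n"
        using row[OF x(1)] nth_mem[OF k] by blast
      have "?y \<notin> set (take k ?r)"
        using row[OF x(1)] k by (auto simp: in_set_conv_nth nth_eq_iff_index_eq)
      then show "?y \<notin> Y \<union> set (take k ?r)"
        using x(3) nth_mem[OF k] by blast
    qed
    have adj: "arr s ''adj'' (?o + k) = int ?y"
      using s(1) concat_nth[OF x(1) k] by (simp add: input_ok_def)
    have body: "runs W ?c s' 26 (?I (Suc k))"
    proof (rule runs_Seq[where R = "\<lambda>u. u = s'\<lparr>var := (var s')(''y'' := int ?y)\<rparr>"])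
      show "runs W (Assign ''y'' (Read ''adj'' (Var ''p''))) s' 3
          (\<lambda>u. u = s'\<lparr>var := (var s')(''y'' := int ?y)\<rparr>)"
        by (rule runs_loop_free)
          (use I s' adj k bounds word_bounds y in \<open>auto simp: nat_int_add\<close>)
    next
      fix u
      assume u: "u = s'\<lparr>var := (var s')(''y'' := int ?y)\<rparr>"
      show "runs W (Seq split_vertex (Assign ''p'' (Plus (Var ''p'') (Const 1)))) u 23 (?I (Suc k))"
      proof (rule runs_Seq)
        show "runs W split_vertex u 19 (\<lambda>t.
            splits n b cls0 (insert ?y (Y \<union> set (take k ?r))) (arr t ''cls'') (arr t ''new'') (var t ''fresh'') \<and>
            var u ''fresh'' \<le> var t ''fresh'' \<and> var t ''fresh'' \<le> var u ''fresh'' + 1)"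
          by (rule runs_split_vertex) (use I s' u y f k word_bounds in auto)
      next
        fix t
        assume "splits n b cls0 (insert ?y (Y \<union> set (take k ?r))) (arr t ''cls'') (arr t ''new'') (var t ''fresh'') \<and>
            var u ''fresh'' \<le> var t ''fresh'' \<and> var t ''fresh'' \<le> var u ''fresh'' + 1"
          and "frame (wvars split_vertex) (warrs split_vertex) u t"
        then show "runs W (Assign ''p'' (Plus (Var ''p'') (Const 1))) t 4 (?I (Suc k))"
          by (intro runs_loop_free)
            (use I u k bounds word_bounds in \<open>auto simp: frame_def take_Suc_conv_app_nth\<close>)
      qed simp
    qed simp
    show "bsafe W ?b s' \<and> bval ?b s' \<and> runs W ?c s' 26 (?I (Suc k))"
      using body I s' start k bounds word_bounds x by (simp add: nat_add_distrib)
  next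
    fix s'
    assume I: "?I (length ?r) s'" and "frame (wvars ?c) (warrs ?c) s s'"
    then have fr: "frame {''y'', ''fresh'', ''p''} {''new'', ''cls''} s s'"
      by (auto intro: frame_mono)
    have s': "var s' ''x'' = int x" "arr s' ''start'' = arr s ''start''"
      using fr x s by (auto simp: frame_def)
    show "bsafe W ?b s' \<and> \<not> bval ?b s'"
      using I s' start bounds word_bounds x by (simp add: nat_add_distrib)
  qed
  then show ?thesis
    unfolding split_neighbours_def by (rule runs_mono) auto
qed

text \<open>In the 38, the outer conditional accounts for 5, setting \<open>base\<close> for 2, the
  closed case for up to 21, loading \<open>p\<close> for 3 and the last test of the inner loop for
  7. A row draws at most one number per neighbour and one more for \<open>x\<close> itself.\<close>

lemma runs_split_row:
  assumes R: "refined L q (alive n (arr s ''rep'')) x f0 (arr s ''cls'') (arr s ''new'') (var s ''fresh'')"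
    and x: "x < n" "var s ''x'' = int x" and s: "input_ok s"
    and rep: "\<And>j. j < n \<Longrightarrow> 0 \<le> arr s ''rep'' j \<and> arr s ''rep'' j \<le> int n"
    and f: "var s ''fresh'' + int (length (L ! x)) + 1 \<le> int W"
  shows "runs W (split_row q) s (33 * length (L ! x) + 38) (\<lambda>s'.
    refined L q (alive n (arr s ''rep'')) (Suc x) f0 (arr s' ''cls'') (arr s' ''new'') (var s' ''fresh'') \<and>
    var s' ''fresh'' \<le> var s ''fresh'' + int (length (L ! x)) + 1)"
    (is "runs W _ s _ ?Q")
  unfolding split_row_def
proof (rule runs_Cond[where ?T1.0 = "33 * length (L ! x) + 33"])
  show "bsafe W (Equal (Read ''rep'' (Var ''x'')) (Var ''x'')) s"
    using x rep[OF x(1)] word_bounds by simp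
next
  assume "\<not> bval (Equal (Read ''rep'' (Var ''x'')) (Var ''x'')) s"
  then have "x \<notin> alive n (arr s ''rep'')"
    using x by (simp add: alive_def)
  then show "runs W Skip s (33 * length (L ! x) + 33) ?Q"
    by (intro runs_loop_free) (use refined_skip[OF R] in auto)
next
  let ?b = "var s ''fresh''"
  let ?Y = "if q then {x} else {}"
  let ?splits = "\<lambda>Y t. splits n ?b (arr s ''cls'') Y (arr t ''cls'') (arr t ''new'') (var t ''fresh'')"
  let ?init = "if q then Seq (Assign ''y'' (Var ''x'')) split_vertex else Skip"
  assume "bval (Equal (Read ''rep'' (Var ''x'')) (Var ''x'')) s"
  then have xA: "x \<in> alive n (arr s ''rep'')"
    using x by (simp add: alive_def)
  have b: "0 \<le> ?b"
    using refinedD(1,2)[OF R] by linarith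
  show "runs W (Seq (Assign ''base'' (Var ''fresh''))
       (Seq ?init (Seq (Assign ''p'' (Read ''start'' (Var ''x''))) split_neighbours)))
     s (33 * length (L ! x) + 33) ?Q"
  proof (rule runs_Seq[where R = "\<lambda>t. t = s\<lparr>var := (var s)(''base'' := ?b)\<rparr>"])
    show "runs W (Assign ''base'' (Var ''fresh'')) s 2 (\<lambda>t. t = s\<lparr>var := (var s)(''base'' := ?b)\<rparr>)"
      by (rule runs_loop_free) (use f b in auto)
  next
    fix t :: state
    assume t: "t = s\<lparr>var := (var s)(''base'' := ?b)\<rparr>"
    have S0: "?splits {} t"
      using refined_splits[OF R] t by simp
    show "runs W (Seq ?init (Seq (Assign ''p'' (Read ''start'' (Var ''x''))) split_neighbours)) t
        (33 * length (L ! x) + 31) ?Q"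
    proof (rule runs_Seq[where R = "\<lambda>t'. ?splits ?Y t' \<and> var t' ''fresh'' \<le> ?b + 1"
          and ?T1.0 = 21 and ?T2.0 = "33 * length (L ! x) + 10"])
      show "runs W ?init t 21 (\<lambda>t'. ?splits ?Y t' \<and> var t' ''fresh'' \<le> ?b + 1)"
      proof (cases q)
        case False
        then show ?thesis
          using S0 t by (auto intro!: runs_loop_free)
      next
        case True
        have "runs W (Seq (Assign ''y'' (Var ''x'')) split_vertex) t 21
          (\<lambda>t'. ?splits {x} t' \<and> var t' ''fresh'' \<le> ?b + 1)"
        proof (rule runs_Seq[where R = "\<lambda>t'. t' = t\<lparr>var := (var t)(''y'' := int x)\<rparr>"])
          show "runs W (Assign ''y'' (Var ''x'')) t 2 (\<lambda>t'. t' = t\<lparr>var := (var t)(''y'' := int x)\<rparr>)"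
            by (rule runs_loop_free) (use x t word_bounds in auto)
          fix t'
          assume t': "t' = t\<lparr>var := (var t)(''y'' := int x)\<rparr>"
          have "runs W split_vertex t' 19 (\<lambda>u. ?splits (insert x {}) u \<and>
              var t' ''fresh'' \<le> var u ''fresh'' \<and> var u ''fresh'' \<le> var t' ''fresh'' + 1)"
            by (rule runs_split_vertex) (use t t' x S0 f word_bounds in auto)
          then show "runs W split_vertex t' 19 (\<lambda>t'. ?splits {x} t' \<and> var t' ''fresh'' \<le> ?b + 1)"
            by (rule runs_mono) (use t t' in auto)
        qed simp
        then show ?thesis
          using True by simp
      qed
    next
      fix u :: state
      assume u: "?splits ?Y u \<and> var u ''fresh'' \<le> ?b + 1"
        and "frame (wvars ?init) (warrs ?init) t u"
      then have "frame {''y'', ''fresh''} {''new'', ''cls''} t u"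
        by (cases q) (auto simp: frame_def)
      then have fr: "frame {''y'', ''fresh'', ''base''} {''new'', ''cls''} s u" "var u ''base'' = ?b"
        unfolding t by (auto simp: frame_def)
      have ok: "input_ok u"
        using input_ok_frame[OF s fr(1)] by simp
      have ux: "var u ''x'' = int x"
        using fr x by (auto simp: frame_def)
      have st: "arr u ''start'' x = int (length (concat (take x L)))"
        using ok x by (simp add: input_ok_def)
      let ?u = "u\<lparr>var := (var u)(''p'' := int (length (concat (take x L))))\<rparr>"
      show "runs W (Seq (Assign ''p'' (Read ''start'' (Var ''x''))) split_neighbours) u
        (33 * length (L ! x) + 10) ?Q"
      proof (rule runs_Seq[where R = "\<lambda>t'. t' = ?u"])
        show "runs W (Assign ''p'' (Read ''start'' (Var ''x''))) u 3 (\<lambda>t'. t' = ?u)"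
          by (rule runs_loop_free)
            (use ux st x word_bounds start_le[of x] in auto)
        fix t'
        assume t': "t' = ?u"
        have "input_ok t'"
          using ok t' by (simp add: input_ok_def)
        have "runs W split_neighbours t' (33 * length (L ! x) + 7) (\<lambda>s'.
            splits n ?b (arr s ''cls'') (?Y \<union> set (L ! x)) (arr s' ''cls'') (arr s' ''new'') (var s' ''fresh'') \<and>
            var s' ''fresh'' \<le> var t' ''fresh'' + int (length (L ! x)))"
          by (rule runs_split_neighbours)
            (use t' u x f ux fr \<open>input_ok t'\<close> row[OF x(1)] in auto)
        then show "runs W split_neighbours t' (33 * length (L ! x) + 7) ?Q"
        proof (rule runs_mono)
          fix s' :: state
          assume s': "splits n ?b (arr s ''cls'') (?Y \<union> set (L ! x)) (arr s' ''cls'') (arr s' ''new'') (var s' ''fresh'') \<and>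
            var s' ''fresh'' \<le> var t' ''fresh'' + int (length (L ! x))"
          then have "splits n ?b (arr s ''cls'') (nbhd L q x) (arr s' ''cls'') (arr s' ''new'') (var s' ''fresh'')"
            by (simp add: nbhd_def Un_commute)
          then show "?Q s'"
            using refined_step[OF R _ xA] s' u t' by auto
        qed simp
      qed simp
    qed simp
  qed simp
qed simp

text \<open>Charging each row by its degree makes the pass linear: the row loop costs at most 46 n
  plus 33 times the sum of the degrees, and a constant. The same count bounds the class numbers
  drawn.\<close>

lemma runs_refine:
  assumes s: "input_ok s"
    and rep: "\<And>j. j < n \<Longrightarrow> 0 \<le> arr s ''rep'' j \<and> arr s ''rep'' j \<le> int n"
    and f: "0 \<le> var s ''fresh''" "var s ''fresh'' + int n + int M + 2 \<le> int W"
    and new: "\<And>k. 0 \<le> arr s ''new'' k \<and> arr s ''new'' k < var s ''fresh''"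
  shows "runs W (refine q) s (57 * n + 33 * M + 16) (\<lambda>s'.
    refined L q (alive n (arr s ''rep'')) n (var s ''fresh'') (arr s' ''cls'') (arr s' ''new'') (var s' ''fresh'') \<and>
    var s' ''fresh'' \<le> var s ''fresh'' + 1 + int n + int M)"
    (is "runs W _ s _ ?Q")
  unfolding refine_def
proof (rule runs_Seq[where R = "\<lambda>t. \<forall>v<n. arr t ''cls'' v = var s ''fresh''"])
  show "runs W (For ''x'' (Write ''cls'' (Var ''x'') (Var ''fresh''))) s (11 * n + 6)
      (\<lambda>t. \<forall>v<n. arr t ''cls'' v = var s ''fresh'')"
  proof (rule runs_For[where I = "\<lambda>k t. \<forall>v<k. arr t ''cls'' v = var s ''fresh''" and T = "\<lambda>_. 3"])
    fix k and t :: state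
    assume "k < n" "\<forall>v<k. arr t ''cls'' v = var s ''fresh''" "var t ''x'' = int k"
      "frame (insert ''x'' (wvars (Write ''cls'' (Var ''x'') (Var ''fresh''))))
        (warrs (Write ''cls'' (Var ''x'') (Var ''fresh''))) s t"
    then show "runs W (Write ''cls'' (Var ''x'') (Var ''fresh'')) t 3
        (\<lambda>t. \<forall>v<Suc k. arr t ''cls'' v = var s ''fresh'')"
      by (intro runs_loop_free) (use f word_bounds in \<open>auto simp: frame_def less_Suc_eq\<close>)
  qed (use s word_bounds in \<open>auto simp: input_ok_def\<close>)
next
  let ?f = "var s ''fresh''"
  let ?A = "alive n (arr s ''rep'')"
  fix t :: state
  assume cls: "\<forall>v<n. arr t ''cls'' v = ?f"
    and "frame (wvars (For ''x'' (Write ''cls'' (Var ''x'') (Var ''fresh''))))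
      (warrs (For ''x'' (Write ''cls'' (Var ''x'') (Var ''fresh'')))) s t"
  then have fr: "frame {''x''} {''cls''} s t"
    by simp
  have tf: "var t ''fresh'' = ?f"
    using fr by (auto simp: frame_def)
  show "runs W (Seq (Assign ''fresh'' (Plus (Var ''fresh'') (Const 1))) (For ''x'' (split_row q))) t
      (46 * n + 33 * M + 10) ?Q"
  proof (rule runs_Seq[where R = "\<lambda>u. u = t\<lparr>var := (var t)(''fresh'' := ?f + 1)\<rparr>"])
    show "runs W (Assign ''fresh'' (Plus (Var ''fresh'') (Const 1))) t 4
        (\<lambda>u. u = t\<lparr>var := (var t)(''fresh'' := ?f + 1)\<rparr>)"
      by (rule runs_loop_free) (use f tf in auto)
  next
    fix u :: state
    assume u: "u = t\<lparr>var := (var t)(''fresh'' := ?f + 1)\<rparr>"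
    have fru: "frame {''x'', ''fresh''} {''cls''} s u"
      using fr unfolding u by (auto simp: frame_def)
    have ok: "input_ok u"
      using input_ok_frame[OF s fru] by simp
    have u': "arr u ''rep'' = arr s ''rep''" "arr u ''new'' = arr s ''new''" "var u ''fresh'' = ?f + 1"
      using fru u by (auto simp: frame_def)
    let ?I = "\<lambda>k s'. refined L q ?A k ?f (arr s' ''cls'') (arr s' ''new'') (var s' ''fresh'') \<and>
      var s' ''fresh'' \<le> ?f + 1 + int k + int (\<Sum>z<k. length (L ! z))"
    have "runs W (For ''x'' (split_row q)) u (46 * n + 33 * M + 6) (?I n)"
    proof (rule runs_For[where I = ?I and T = "\<lambda>x. 33 * length (L ! x) + 38"])
      show "?I 0 u"
        using cls f u' u new by (auto simp: refined_def intro: less_imp_le)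
    next
      fix k and s' :: state
      assume k: "k < n" and I: "?I k s'" and sx: "var s' ''x'' = int k"
        and frs: "frame (insert ''x'' (wvars (split_row q))) (warrs (split_row q)) u s'"
      have ok': "input_ok s'"
        using input_ok_frame[OF ok frs] by simp
      have rep': "arr s' ''rep'' = arr s ''rep''"
        using frs u' by (simp add: frame_def)
      have "Suc k + ((\<Sum>z<k. length (L ! z)) + length (L ! k)) \<le> n + M"
        using sum_degrees[of "Suc k"] k by simp
      then have f': "var s' ''fresh'' + int (length (L ! k)) + 1 \<le> int W"
        using I f by linarith
      have "runs W (split_row q) s' (33 * length (L ! k) + 38) (\<lambda>t'.
          refined L q (alive n (arr s' ''rep'')) (Suc k) ?f (arr t' ''cls'') (arr t' ''new'') (var t' ''fresh'') \<and>
          var t' ''fresh'' \<le> var s' ''fresh'' + int (length (L ! k)) + 1)"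
        by (rule runs_split_row) (use I k sx ok' rep rep' f' in auto)
      then show "runs W (split_row q) s' (33 * length (L ! k) + 38) (?I (Suc k))"
        by (rule runs_mono) (use I rep' in \<open>auto simp del: of_nat_sum\<close>)
    next
      have "(\<Sum>k<n. 33 * length (L ! k) + 38 + 8) = 33 * (\<Sum>k<n. length (L ! k)) + 46 * n"
        by (simp add: sum.distrib sum_distrib_left)
      then show "(\<Sum>k<n. 33 * length (L ! k) + 38 + 8) + 6 \<le> 46 * n + 33 * M + 6"
        using sum_degrees[of n] by simp
    qed (use ok word_bounds in \<open>auto simp: input_ok_def\<close>)
    then show "runs W (For ''x'' (split_row q)) u (46 * n + 33 * M + 6) ?Q"
      by (rule runs_mono) (use sum_degrees[of n] in \<open>auto simp del: of_nat_sum\<close>)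
  qed simp
qed simp

text \<open>The second assumption on \<open>seen\<close> holds in every round because earlier
  searches wrote only at class numbers below \<open>f0\<close>; hence nothing has to be
  cleared.\<close>

lemma runs_search:
  assumes s: "input_ok s"
    and rep: "\<And>j. j < n \<Longrightarrow> 0 \<le> arr s ''rep'' j \<and> arr s ''rep'' j \<le> int n"
    and cls: "\<And>v. v < n \<Longrightarrow> f0 \<le> arr s ''cls'' v \<and> arr s ''cls'' v < f"
    and f: "0 \<le> f0" "f0 \<le> f" "f \<le> int W"
    and seen: "\<And>k. 0 \<le> arr s ''seen'' k \<and> arr s ''seen'' k \<le> int n"
      "\<And>k. f0 \<le> int k \<Longrightarrow> arr s ''seen'' k = 0"
  shows "runs W search s (29 * n + 8) (\<lambda>s'. searched n (alive n (arr s ''rep'')) n f0 f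
    (arr s ''cls'') (arr s' ''seen'') (var s' ''found'') (var s' ''pu'') (var s' ''pv''))"
  unfolding search_def
proof (rule runs_Seq[where R = "\<lambda>t. t = s\<lparr>var := (var s)(''found'' := 0)\<rparr>"])
  show "runs W (Assign ''found'' (Const 0)) s 2 (\<lambda>t. t = s\<lparr>var := (var s)(''found'' := 0)\<rparr>)"
    by (rule runs_loop_free) auto
next
  let ?A = "alive n (arr s ''rep'')"
  let ?S = "\<lambda>k s'. searched n ?A k f0 f
    (arr s ''cls'') (arr s' ''seen'') (var s' ''found'') (var s' ''pu'') (var s' ''pv'')"
  fix t :: state
  assume t: "t = s\<lparr>var := (var s)(''found'' := 0)\<rparr>"
  show "runs W (For ''x'' search_step) t (29 * n + 6) (?S n)"
  proof (rule runs_For[where T = "\<lambda>_. 21" and I = ?S])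
    show "?S 0 t"
    proof -
      have "\<forall>k. f \<le> int k \<longrightarrow> arr s ''seen'' k = 0"
        using seen(2) f(2) by (meson order_trans)
      then show ?thesis
        using seen t by (auto simp: searched_def)
    qed
  next
    fix k and s' :: state
    assume k: "k < n" and S: "?S k s'" and sx: "var s' ''x'' = int k"
      and "frame (insert ''x'' (wvars search_step)) (warrs search_step) t s'"
    then have s': "arr s' ''rep'' = arr s ''rep''" "arr s' ''cls'' = arr s ''cls''"
      using t by (auto simp: frame_def)
    let ?c = "arr s ''cls'' k"
    have c: "0 \<le> ?c" "f0 \<le> ?c" "?c < f" "?c \<le> int W"
      using cls[OF k] f by linarith+
    have sb: "0 \<le> arr s' ''seen'' i" "arr s' ''seen'' i \<le> int W" "\<bar>arr s' ''seen'' i - 1\<bar> \<le> int W" for i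
    proof -
      have "0 \<le> arr s' ''seen'' i" "arr s' ''seen'' i \<le> int n"
        using S unfolding searched_def by blast+
      then show "0 \<le> arr s' ''seen'' i" "arr s' ''seen'' i \<le> int W" "\<bar>arr s' ''seen'' i - 1\<bar> \<le> int W"
        using word_bounds by linarith+
    qed
    have rb: "0 \<le> arr s ''rep'' k" "arr s ''rep'' k \<le> int W" "int k + 1 \<le> int W" "1 \<le> int W"
      using rep[OF k] word_bounds k by linarith+
    show "runs W search_step s' 21 (?S (Suc k))"
    proof (rule runs_loop_free)
      show "csafe W search_step s'"
        using c sb rb sx s' by (simp add: search_step_def)
      show "ccost search_step \<le> 21"
        by (simp add: search_step_def)
      consider "k \<notin> ?A" | "k \<in> ?A" "arr s' ''seen'' (nat ?c) = 0"
        | "k \<in> ?A" "arr s' ''seen'' (nat ?c) \<noteq> 0"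
        by blast
      then show "?S (Suc k) (final search_step s')"
      proof cases
        case 1
        then show ?thesis
          using searched_skip[OF S 1] k sx s' by (simp add: search_step_def alive_def)
      next
        case 2
        then show ?thesis
          using searched_new[OF S 2(1) k f(1) c(2,3) 2(2)] sx s'
          by (simp add: search_step_def alive_def add.commute)
      next
        case 3
        then show ?thesis
          using searched_old[OF S 3(1) f(1) c(2) 3(2)] sx s'
          by (simp add: search_step_def alive_def)
      qed
    qed
  qed (use s t word_bounds in \<open>auto simp: input_ok_def\<close>)
qed simp

lemma adj_rel_input: "adj_rel (adj_in L) {..<n}"
  using row row_sym unfolding adj_rel_def by blast

text \<open>Updating in place is safe because entries from the loop index on still hold their old
  values. The loop takes at most 16 n + 6 steps; the larger bound is that of
  \<open>merge_true\<close>, so that both share one estimate.\<close>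

lemma runs_merge_false:
  assumes s: "input_ok s" "var s ''pu'' = int u" "var s ''pv'' = int v" "u < n" "v < n"
    and rep: "\<And>j. j < n \<Longrightarrow> 0 \<le> arr s ''rep'' j \<and> arr s ''rep'' j \<le> int n"
  shows "runs W merge_false s (28 * n + 10) (\<lambda>s'.
    \<forall>j<n. arr s' ''rep'' j = (if arr s ''rep'' j = int v then int u else arr s ''rep'' j))"
proof -
  let ?r = "arr s ''rep''"
  let ?I = "\<lambda>k s'. \<forall>j. arr s' ''rep'' j = (if j < k \<and> ?r j = int v then int u else ?r j)"
  have "runs W merge_false s (28 * n + 10) (?I n)"
    unfolding merge_false_def
  proof (rule runs_For[where I = ?I and T = "\<lambda>_. 8"])
    let ?c = "Cond (Equal (Read ''rep'' (Var ''j'')) (Var ''pv'')) (Write ''rep'' (Var ''j'') (Var ''pu'')) Skip"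
    fix k and s' :: state
    assume k: "k < n" and I: "?I k s'" and j: "var s' ''j'' = int k"
      and "frame (insert ''j'' (wvars ?c)) (warrs ?c) s s'"
    then have pv: "var s' ''pu'' = int u" "var s' ''pv'' = int v"
      using s by (auto simp: frame_def)
    have rk: "arr s' ''rep'' k = ?r k" "0 \<le> ?r k" "?r k \<le> int W"
      using I rep[OF k] word_bounds by auto
    show "runs W ?c s' 8 (?I (Suc k))"
      by (rule runs_loop_free)
        (use I k j pv rk s word_bounds in \<open>auto simp: less_Suc_eq\<close>)
  qed (use s word_bounds in \<open>auto simp: input_ok_def\<close>)
  then show ?thesis
    by (rule runs_mono) auto
qed

lemma runs_merge_true:
  assumes s: "input_ok s" "var s ''pu'' = int u" "var s ''pv'' = int v" "u < n" "v < n" "u \<noteq> v"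
    and m: "var s ''size'' = int m" "m < n"
    and rep: "\<And>j. j < n \<Longrightarrow> 0 \<le> arr s ''rep'' j \<and> arr s ''rep'' j \<le> int n"
  shows "runs W merge_true s (28 * n + 10) (\<lambda>s'. var s' ''size'' = int (Suc m) \<and>
    (\<forall>j<n. arr s' ''rep'' j = (if arr s ''rep'' j = int v then int n else arr s ''rep'' j)) \<and>
    (\<forall>k<m * n. arr s' ''coeff'' k = arr s ''coeff'' k) \<and>
    (\<forall>j<n. arr s' ''coeff'' (m * n + j) =
      (if arr s ''rep'' j = int u then 1 else if arr s ''rep'' j = int v then - 1 else 0)))"
proof -
  let ?r = "arr s ''rep''"
  let ?g = "\<lambda>j. if ?r j = int u then 1 else if ?r j = int v then - 1 else 0 :: int"
  let ?I = "\<lambda>k s'. (\<forall>j. arr s' ''rep'' j = (if j < k \<and> ?r j = int v then int n else ?r j)) \<and>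
    (\<forall>k<m * n. arr s' ''coeff'' k = arr s ''coeff'' k) \<and>
    (\<forall>j<k. arr s' ''coeff'' (m * n + j) = ?g j)"
  let ?c = "Cond (Equal (Read ''rep'' (Var ''j'')) (Var ''pu''))
       (Write ''coeff'' coeff_index (Const 1))
       (Cond (Equal (Read ''rep'' (Var ''j'')) (Var ''pv''))
         (Seq (Write ''coeff'' coeff_index (Const (- 1))) (Write ''rep'' (Var ''j'') (Var ''n'')))
         (Write ''coeff'' coeff_index (Const 0)))"
  \<comment> \<open>All indices of row \<open>m\<close> lie below (m + 1) n \<le> n n, which is
    where the square in the word bound enters.\<close>
  have "Suc m * n \<le> n * n"
    using m(2) by (intro mult_le_mono1) simp
  then have mn: "m * n + n \<le> W"
    using word_bounds by simp
  show ?thesis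
    unfolding merge_true_def
  proof (rule runs_Seq)
    show "runs W (For ''j'' ?c) s (28 * n + 6) (?I n)"
    proof (rule runs_For[where I = ?I and T = "\<lambda>_. 20"])
      fix k and s' :: state
      assume k: "k < n" and I: "?I k s'" and j: "var s' ''j'' = int k"
        and "frame (insert ''j'' (wvars ?c)) (warrs ?c) s s'"
      then have pv: "var s' ''pu'' = int u" "var s' ''pv'' = int v" "var s' ''size'' = int m" "var s' ''n'' = int n"
        using s m by (auto simp: frame_def input_ok_def)
      have rk: "arr s' ''rep'' k = ?r k" "0 \<le> ?r k" "?r k \<le> int W"
        using I rep[OF k] word_bounds by auto
      have idx: "nat (int m * int n + int k) = m * n + k"
        by (metis nat_int of_nat_add of_nat_mult)
      have "int (m * n + k) \<le> int W" "int (m * n) \<le> int W"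
        using mn k by linarith+
      then have bd: "int m * int n + int k \<le> int W" "int m * int n \<le> int W" "0 \<le> int m * int n"
        "int m \<le> int W" "int n \<le> int W" "int k \<le> int W" "int u \<le> int W" "int v \<le> int W" "1 \<le> int W"
        using m k s word_bounds by simp_all
      have nn: "\<bar>int m * int n\<bar> = int m * int n" "\<bar>int m * int n + int k\<bar> = int m * int n + int k"
        by simp_all
      show "runs W ?c s' 20 (?I (Suc k))"
      proof (rule runs_loop_free)
        show "csafe W ?c s'"
          using bd nn rk pv j by simp
        show "ccost ?c \<le> 20"
          by simp
        show "?I (Suc k) (final ?c s')"
          using I pv j rk idx s(6) by (auto simp: less_Suc_eq)
      qed
    qed (use s word_bounds in \<open>auto simp: input_ok_def\<close>)
  next
    fix t :: state
    assume t: "?I n t" "frame (wvars (For ''j'' ?c)) (warrs (For ''j'' ?c)) s t"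
    show "runs W (Assign ''size'' (Plus (Var ''size'') (Const 1))) t 4
      (\<lambda>s'. var s' ''size'' = int (Suc m) \<and>
        (\<forall>j<n. arr s' ''rep'' j = (if ?r j = int v then int n else ?r j)) \<and>
        (\<forall>k<m * n. arr s' ''coeff'' k = arr s ''coeff'' k) \<and>
        (\<forall>j<n. arr s' ''coeff'' (m * n + j) = ?g j))"
      by (rule runs_loop_free) (use t m word_bounds in \<open>auto simp: frame_def\<close>)
  qed simp
qed

definition reduced_state :: "state \<Rightarrow> bool" where
  "reduced_state s \<longleftrightarrow>
     (\<exists>m. var s ''size'' = int m \<and> reduced n (adj_in L) (arr s ''rep'') m (arr s ''coeff''))"

lemma reduced_rep_bounds: "reduced n E rep m coeff \<Longrightarrow> j < n \<Longrightarrow> 0 \<le> rep j \<and> rep j \<le> int n"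
  unfolding reduced_def alive_def by fastforce

lemma runs_merge:
  assumes s: "input_ok s" "reduced_state s"
    and found: "var s ''found'' = 0 \<or> var s ''found'' = 1 \<and>
      (\<exists>u v. twins q (adj_in L) (alive n (arr s ''rep'')) u v \<and>
        var s ''pu'' = int u \<and> var s ''pv'' = int v)"
  shows "runs W (Cond (Equal (Var ''found'') (Const 1)) (if q then merge_true else merge_false) Skip) s
    (28 * n + 14) (\<lambda>s'. reduced_state s' \<and>
      (if var s ''found'' = 0 then arr s' ''rep'' = arr s ''rep''
       else card (alive n (arr s' ''rep'')) < card (alive n (arr s ''rep''))))"
    (is "runs W _ s _ ?Q")
proof (rule runs_Cond[where ?T1.0 = "28 * n + 10"])
  show "bsafe W (Equal (Var ''found'') (Const 1)) s"
    using found word_bounds by auto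
next
  assume "\<not> bval (Equal (Var ''found'') (Const 1)) s"
  then show "runs W Skip s (28 * n + 10) ?Q"
    using found s by (intro runs_loop_free) auto
next
  let ?r = "arr s ''rep''"
  assume "bval (Equal (Var ''found'') (Const 1)) s"
  then obtain u v where f: "var s ''found'' = 1" "twins q (adj_in L) (alive n ?r) u v"
      "var s ''pu'' = int u" "var s ''pv'' = int v"
    using found by auto
  obtain m where m: "var s ''size'' = int m" "reduced n (adj_in L) ?r m (arr s ''coeff'')"
    using s(2) by (auto simp: reduced_state_def)
  have uv: "u \<in> alive n ?r" "v \<in> alive n ?r" "u \<noteq> v"
    using f(2) by (auto simp: twins_def)
  then have uvn: "u < n" "v < n"
    by (auto simp: alive_def)
  \<comment> \<open>A survivor exists, so the count in \<open>reduced\<close> leaves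
    \<open>m\<close> below \<open>n\<close> and thus room for another row.\<close>
  have "0 < card (alive n ?r)"
    using uv by (auto simp: card_gt_0_iff)
  then have mn: "m < n"
    using m(2) by (auto simp: reduced_def)
  have less: "card (alive n ?r - {v}) < card (alive n ?r)"
    using uv by (intro psubset_card_mono) auto
  note rep = reduced_rep_bounds[OF m(2)]
  show "runs W (if q then merge_true else merge_false) s (28 * n + 10) ?Q"
  proof (cases q)
    case True
    have "runs W merge_true s (28 * n + 10) ?Q"
    proof (rule runs_mono[OF runs_merge_true[OF s(1) f(3,4) uvn uv(3) m(1) mn rep]])
      fix s' :: state
      assume s': "var s' ''size'' = int (Suc m) \<and>
        (\<forall>j<n. arr s' ''rep'' j = (if ?r j = int v then int n else ?r j)) \<and>
        (\<forall>k<m * n. arr s' ''coeff'' k = arr s ''coeff'' k) \<and>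
        (\<forall>j<n. arr s' ''coeff'' (m * n + j) =
          (if ?r j = int u then 1 else if ?r j = int v then - 1 else 0))"
      have t: "twins True (adj_in L) (alive n ?r) u v"
        using f(2) True by simp
      have 1: "reduced n (adj_in L) (arr s' ''rep'') (Suc m) (arr s' ''coeff'')"
        and 2: "alive n (arr s' ''rep'') = alive n ?r - {v}"
        by (rule reduced_true_twins[OF m(2) adj_rel_input t, where coeff' = "arr s' ''coeff''"];
            use s' in simp)+
      have "reduced_state s'"
        unfolding reduced_state_def using s' 1 by (intro exI[of _ "Suc m"] conjI) simp
      then show "?Q s'"
        using less by (simp add: f(1) 2)
    qed auto
    then show ?thesis
      using True by simp
  next
    case False
    have "runs W merge_false s (28 * n + 10) ?Q"
    proof (rule runs_mono[OF runs_merge_false[OF s(1) f(3,4) uvn rep]])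
      fix s' :: state
      assume s': "\<forall>j<n. arr s' ''rep'' j = (if ?r j = int v then int u else ?r j)"
        and fr: "frame (wvars merge_false) (warrs merge_false) s s'"
      have t: "twins False (adj_in L) (alive n ?r) u v"
        using f(2) False by simp
      have 1: "reduced n (adj_in L) (arr s' ''rep'') m (arr s ''coeff'')"
        and 2: "alive n (arr s' ''rep'') = alive n ?r - {v}"
        by (rule reduced_false_twins[OF m(2) adj_rel_input t]; use s' in simp)+
      have "var s' ''size'' = int m" "arr s' ''coeff'' = arr s ''coeff''"
        using fr m(1) by (auto simp: frame_def)
      then have "reduced_state s'"
        unfolding reduced_state_def using 1 by (intro exI[of _ m]) simp
      then show "?Q s'"
        using less by (simp add: f(1) 2)
    qed auto
    then show ?thesis
      using False by simp
  qed
qed simp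

text \<open>\<open>F\<close> caps \<open>fresh\<close> and serves the word bound. The conditions
  that tie \<open>new\<close> and \<open>seen\<close> to \<open>fresh\<close> are what allows both
  tables to be reused uncleared.\<close>

definition round_inv :: "int \<Rightarrow> state \<Rightarrow> bool" where
  "round_inv F s \<longleftrightarrow> input_ok s \<and> reduced_state s \<and> 1 \<le> var s ''fresh'' \<and> var s ''fresh'' \<le> F \<and>
     (\<forall>k. 0 \<le> arr s ''new'' k \<and> arr s ''new'' k < var s ''fresh'') \<and>
     (\<forall>k. 0 \<le> arr s ''seen'' k \<and> arr s ''seen'' k \<le> int n) \<and>
     (\<forall>k. var s ''fresh'' \<le> int k \<longrightarrow> arr s ''seen'' k = 0)"

text \<open>The parts add up to 114 n + 33 M + 38. The search comes back empty only if class numbers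
  are injective on the survivors, which means that there are no twins of kind
  \<open>q\<close>.\<close>

lemma runs_round:
  assumes inv: "round_inv F s" and F: "F + int n + int M + 2 \<le> int W"
  shows "runs W (round_com q) s (114 * (n + M + 1)) (\<lambda>s'. round_inv (F + 1 + int n + int M) s' \<and>
    (if \<exists>u v. twins q (adj_in L) (alive n (arr s ''rep'')) u v
     then card (alive n (arr s' ''rep'')) < card (alive n (arr s ''rep''))
     else alive n (arr s' ''rep'') = alive n (arr s ''rep'')))"
    (is "runs W _ s _ ?Q")
proof -
  let ?A = "alive n (arr s ''rep'')"
  let ?f = "var s ''fresh''"
  let ?merge = "Cond (Equal (Var ''found'') (Const 1)) (if q then merge_true else merge_false) Skip"
  have ok: "input_ok s" and red: "reduced_state s"
    and f: "1 \<le> ?f" "?f \<le> F"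
    and new: "\<And>k. 0 \<le> arr s ''new'' k \<and> arr s ''new'' k < ?f"
    and seen: "\<And>k. 0 \<le> arr s ''seen'' k \<and> arr s ''seen'' k \<le> int n"
      "\<And>k. ?f \<le> int k \<Longrightarrow> arr s ''seen'' k = 0"
    using inv unfolding round_inv_def by blast+
  have rep: "0 \<le> arr s ''rep'' j \<and> arr s ''rep'' j \<le> int n" if "j < n" for j
    using red reduced_rep_bounds that unfolding reduced_state_def by blast
  have AL: "?A \<subseteq> {..<n}"
    by (rule alive_subset)
  have "runs W (round_com q) s ((57 * n + 33 * M + 16) + ((29 * n + 8) + (28 * n + 14))) ?Q"
    unfolding round_com_def
  proof (rule runs_Seq)
    show "runs W (refine q) s (57 * n + 33 * M + 16) (\<lambda>s'.
        refined L q ?A n ?f (arr s' ''cls'') (arr s' ''new'') (var s' ''fresh'') \<and>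
        var s' ''fresh'' \<le> ?f + 1 + int n + int M)"
      by (rule runs_refine[OF ok rep _ _ new]) (use f F in auto)
  next
    fix t :: state
    let ?g = "var t ''fresh''"
    let ?c = "arr t ''cls''"
    assume "refined L q ?A n ?f ?c (arr t ''new'') ?g \<and> ?g \<le> ?f + 1 + int n + int M"
      and frt: "frame (wvars (refine q)) (warrs (refine q)) s t"
    then have R: "refined L q ?A n ?f ?c (arr t ''new'') ?g" and g: "?g \<le> ?f + 1 + int n + int M"
      by auto
    have okt: "input_ok t"
      using input_ok_frame[OF ok frt] by simp
    have t: "arr t ''rep'' = arr s ''rep''" "arr t ''seen'' = arr s ''seen''"
      "arr t ''coeff'' = arr s ''coeff''" "var t ''size'' = var s ''size''"
      using frt by (auto simp: frame_def)
    show "runs W (Seq search ?merge) t ((29 * n + 8) + (28 * n + 14)) ?Q"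
    proof (rule runs_Seq)
      show "runs W search t (29 * n + 8) (\<lambda>s'. searched n (alive n (arr t ''rep'')) n ?f ?g
          ?c (arr s' ''seen'') (var s' ''found'') (var s' ''pu'') (var s' ''pv''))"
      proof (rule runs_search[OF okt])
        show "?f \<le> ?c v \<and> ?c v < ?g" if "v < n" for v
          using refinedD(3,4)[OF R that] by blast
        show "?f \<le> ?g"
          using refinedD(2)[OF R] .
      qed (use rep t f g F seen in auto)
    next
      fix u :: state
      assume "searched n (alive n (arr t ''rep'')) n ?f ?g
          ?c (arr u ''seen'') (var u ''found'') (var u ''pu'') (var u ''pv'')"
        and fru: "frame (wvars search) (warrs search) t u"
      then have S: "searched n ?A n ?f ?g
          ?c (arr u ''seen'') (var u ''found'') (var u ''pu'') (var u ''pv'')"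
        unfolding t by simp
      have oku: "input_ok u"
        using input_ok_frame[OF okt fru] by simp
      have u: "arr u ''rep'' = arr s ''rep''" "arr u ''coeff'' = arr s ''coeff''"
        "var u ''size'' = var s ''size''" "var u ''fresh'' = ?g" "arr u ''new'' = arr t ''new''"
        using fru t by (auto simp: frame_def)
      have redu: "reduced_state u"
        using red unfolding reduced_state_def u .
      have An: "{v \<in> ?A. v < n} = ?A"
        using AL by auto
      have found: "if var u ''found'' = 0 then inj_on ?c ?A
        else var u ''found'' = 1 \<and> (\<exists>a\<in>?A. \<exists>b\<in>?A. a \<noteq> b \<and> ?c a = ?c b \<and>
          var u ''pu'' = int a \<and> var u ''pv'' = int b)"
        using S unfolding searched_def An by (elim conjE)
      have tw: "?c a = ?c b \<longleftrightarrow> twins q (adj_in L) ?A a b" if "a \<in> ?A" "b \<in> ?A" "a \<noteq> b" for a b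
        using refined_twins[OF R AL that] .
      have no: "\<not> twins q (adj_in L) ?A a b" if "var u ''found'' = 0" for a b
      proof
        assume ab: "twins q (adj_in L) ?A a b"
        then have "a \<in> ?A" "b \<in> ?A" "a \<noteq> b"
          by (auto simp: twins_def)
        moreover from this have "?c a = ?c b"
          using tw ab by blast
        ultimately show False
          using found that by (auto dest: inj_onD)
      qed
      have yes: "var u ''found'' = 1 \<and> (\<exists>a b. twins q (adj_in L) ?A a b \<and>
          var u ''pu'' = int a \<and> var u ''pv'' = int b)" if "var u ''found'' \<noteq> 0"
        using found that tw by auto
      have seenu: "0 \<le> arr u ''seen'' k \<and> arr u ''seen'' k \<le> int n"
        "?g \<le> int k \<Longrightarrow> arr u ''seen'' k = 0" for k
        using S unfolding searched_def by blast+
      have "runs W ?merge u (28 * n + 14) (\<lambda>s'. reduced_state s' \<and>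
          (if var u ''found'' = 0 then arr s' ''rep'' = arr u ''rep''
           else card (alive n (arr s' ''rep'')) < card (alive n (arr u ''rep''))))"
        by (rule runs_merge[OF oku redu]) (use yes u in auto)
      then show "runs W ?merge u (28 * n + 14) ?Q"
      proof (rule runs_mono)
        fix s' :: state
        assume m: "reduced_state s' \<and>
          (if var u ''found'' = 0 then arr s' ''rep'' = arr u ''rep''
           else card (alive n (arr s' ''rep'')) < card (alive n (arr u ''rep'')))"
          and "frame (wvars ?merge) (warrs ?merge) u s'"
        then have frs: "frame {''j'', ''size''} {''coeff'', ''rep''} u s'"
          by (cases q) (auto simp: frame_def)
        have oks: "input_ok s'"
          using input_ok_frame[OF oku frs] by simp
        have s': "var s' ''fresh'' = ?g" "arr s' ''new'' = arr t ''new''" "arr s' ''seen'' = arr u ''seen''"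
          using frs u by (auto simp: frame_def)
        have "round_inv (F + 1 + int n + int M) s'"
          unfolding round_inv_def s'
          using oks m f g seenu refinedD(2,5,6)[OF R] by auto
        then show "?Q s'"
          using m no yes u by (auto split: if_splits)
      qed simp
    qed simp
  qed simp
  then show ?thesis
    by (rule runs_mono) auto
qed

lemma runs_program:
  assumes n: "0 < n" and s: "input_ok s" "\<And>a k. a \<notin> {''start'', ''adj''} \<Longrightarrow> arr s a k = 0"
      "var s ''size'' = 0"
    and twins: "\<And>A. A \<subseteq> {..<n} \<Longrightarrow> 2 \<le> card A \<Longrightarrow> \<exists>q u v. twins q (adj_in L) A u v"
  shows "runs W program s (250 * (n * (n + M + 1)))
    (\<lambda>s'. reduced_state s' \<and> card (alive n (arr s' ''rep'')) = 1)"
  unfolding program_def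
proof (rule runs_Seq[where R = "\<lambda>t. \<forall>j<n. arr t ''rep'' j = int j"])
  show "runs W (For ''x'' (Write ''rep'' (Var ''x'') (Var ''x''))) s (11 * n + 6)
      (\<lambda>t. \<forall>j<n. arr t ''rep'' j = int j)"
  proof (rule runs_For[where I = "\<lambda>k t. \<forall>j<k. arr t ''rep'' j = int j" and T = "\<lambda>_. 3"])
    fix k and t :: state
    assume "k < n" "\<forall>j<k. arr t ''rep'' j = int j" "var t ''x'' = int k"
    then show "runs W (Write ''rep'' (Var ''x'') (Var ''x'')) t 3 (\<lambda>t. \<forall>j<Suc k. arr t ''rep'' j = int j)"
      by (intro runs_loop_free) (use word_bounds in \<open>auto simp: less_Suc_eq\<close>)
  qed (use s word_bounds in \<open>auto simp: input_ok_def\<close>)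
next
  fix t :: state
  let ?d = "1 + int n + int M"
  assume rep: "\<forall>j<n. arr t ''rep'' j = int j"
    and "frame (wvars (For ''x'' (Write ''rep'' (Var ''x'') (Var ''x''))))
      (warrs (For ''x'' (Write ''rep'' (Var ''x'') (Var ''x'')))) s t"
  then have fr: "frame {''x''} {''rep''} s t"
    by simp
  show "runs W (Seq (Assign ''fresh'' (Const 1)) (For ''i'' (Seq (round_com False) (round_com True)))) t
      (n * (228 * (n + M + 1) + 8) + 8)
      (\<lambda>s'. reduced_state s' \<and> card (alive n (arr s' ''rep'')) = 1)"
  proof (rule runs_Seq[where R = "\<lambda>u. u = t\<lparr>var := (var t)(''fresh'' := 1)\<rparr>"])
    show "runs W (Assign ''fresh'' (Const 1)) t 2 (\<lambda>u. u = t\<lparr>var := (var t)(''fresh'' := 1)\<rparr>)"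
      by (rule runs_loop_free) (use word_bounds in auto)
  next
    fix u :: state
    assume u: "u = t\<lparr>var := (var t)(''fresh'' := 1)\<rparr>"
    have fru: "frame {''x'', ''fresh''} {''rep''} s u"
      using fr u by (auto simp: frame_def)
    have ok: "input_ok u"
      using input_ok_frame[OF s(1) fru] by simp
    have "arr u ''new'' = arr s ''new''" "arr u ''seen'' = arr s ''seen''" "var u ''size'' = var s ''size''"
      using fru by (simp_all add: frame_def)
    then have u': "arr u ''new'' k = 0" "arr u ''seen'' k = 0" "var u ''size'' = 0" "var u ''fresh'' = 1" for k
      using s(2)[of "''new''" k] s(2)[of "''seen''" k] s(3) u by simp_all
    have repu: "\<And>j. j < n \<Longrightarrow> arr u ''rep'' j = int j"
      using rep u by simp
    \<comment> \<open>Each round makes two refinements, each drawing at most \<open>?d\<close> class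
      numbers. The \<open>max\<close> covers the idle rounds after a single vertex is left.\<close>
    let ?I = "\<lambda>k s'. round_inv (1 + 2 * int k * ?d) s' \<and> card (alive n (arr s' ''rep'')) \<le> max 1 (n - k)"
    have "runs W (For ''i'' (Seq (round_com False) (round_com True))) u
        (n * (228 * (n + M + 1) + 8) + 6) (?I n)"
    proof (rule runs_For[where I = ?I and T = "\<lambda>_. 228 * (n + M + 1)"])
      show "?I 0 u"
        using ok u' reduced_initial[OF n repu] by (auto simp: round_inv_def reduced_state_def)
      show "?I k (s'\<lparr>var := (var s')(''i'' := v)\<rparr>) = ?I k s'" for k s' v
        by (simp add: round_inv_def reduced_state_def input_ok_def)
    next
      fix k and s' :: state
      assume k: "k < n" and I: "?I k s'"
      have "int (2 * Suc k * (n + M + 1)) \<le> int (2 * n * (n + M + 1))"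
        using k by (intro of_nat_mono mult_le_mono) auto
      then have "2 * int k * ?d + 2 * ?d \<le> int (2 * n * (n + M + 1))"
        by (simp add: algebra_simps)
      moreover have "int (2 * n * (n + M + 1)) + int n + int M + 10 \<le> int W"
        using word by linarith
      ultimately have F: "1 + 2 * int k * ?d + 2 * ?d + int n + int M + 2 \<le> int W"
        by linarith
      let ?A = "alive n (arr s' ''rep'')"
      show "runs W (Seq (round_com False) (round_com True)) s' (228 * (n + M + 1)) (?I (Suc k))"
      proof (rule runs_Seq)
        show "runs W (round_com False) s' (114 * (n + M + 1))
          (\<lambda>t. round_inv (1 + 2 * int k * ?d + 1 + int n + int M) t \<and>
            (if \<exists>u v. twins False (adj_in L) ?A u v then card (alive n (arr t ''rep'')) < card ?A
             else alive n (arr t ''rep'') = ?A))"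
          by (rule runs_round) (use I F in auto)
      next
        fix t :: state
        let ?B = "alive n (arr t ''rep'')"
        assume t: "round_inv (1 + 2 * int k * ?d + 1 + int n + int M) t \<and>
          (if \<exists>u v. twins False (adj_in L) ?A u v then card ?B < card ?A else ?B = ?A)"
        have "runs W (round_com True) t (114 * (n + M + 1))
          (\<lambda>u. round_inv (1 + 2 * int k * ?d + 1 + int n + int M + 1 + int n + int M) u \<and>
            (if \<exists>u v. twins True (adj_in L) ?B u v then card (alive n (arr u ''rep'')) < card ?B
             else alive n (arr u ''rep'') = ?B))"
          by (rule runs_round) (use t F in auto)
        then show "runs W (round_com True) t (114 * (n + M + 1)) (?I (Suc k))"
        proof (rule runs_mono)
          fix u :: state
          let ?C = "alive n (arr u ''rep'')"
          assume u: "round_inv (1 + 2 * int k * ?d + 1 + int n + int M + 1 + int n + int M) u \<and>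
            (if \<exists>u v. twins True (adj_in L) ?B u v then card ?C < card ?B else ?C = ?B)"
          have "card ?C \<le> card ?B" "card ?B \<le> card ?A"
            using t u by (auto split: if_splits)
          \<comment> \<open>Without false twins the first half leaves the survivors unchanged, so
            the true twins that must then exist are still there for the second half.\<close>
          moreover have "card ?C < card ?A" if "2 \<le> card ?A"
          proof (cases "\<exists>u v. twins False (adj_in L) ?A u v")
            case True
            then show ?thesis
              using t \<open>card ?C \<le> card ?B\<close> by auto
          next
            case False
            then have "\<exists>u v. twins True (adj_in L) ?A u v"
              using twins[OF alive_subset that] by (metis (full_types))
            then show ?thesis
              using False t u by auto
          qed
          ultimately have "card ?C \<le> max 1 (n - Suc k)"
            using I by linarith
          moreover have "1 + 2 * int k * ?d + 1 + int n + int M + 1 + int n + int M = 1 + 2 * int (Suc k) * ?d"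
            by (simp add: algebra_simps)
          then have "round_inv (1 + 2 * int (Suc k) * ?d) u"
            using conjunct1[OF u] by (simp only:)
          ultimately show "?I (Suc k) u"
            by blast
        qed simp
      qed simp
    next
      show "(\<Sum>k<n. 228 * (n + M + 1) + 8) + 6 \<le> n * (228 * (n + M + 1) + 8) + 6"
        by simp
    qed (use ok word_bounds in \<open>auto simp: input_ok_def\<close>)
    then show "runs W (For ''i'' (Seq (round_com False) (round_com True))) u
        (n * (228 * (n + M + 1) + 8) + 6)
        (\<lambda>s'. reduced_state s' \<and> card (alive n (arr s' ''rep'')) = 1)"
    proof (rule runs_mono)
      fix s' :: state
      assume I: "?I n s'"
      then have "reduced_state s'"
        by (simp add: round_inv_def)
      \<comment> \<open>\<open>reduced\<close> always keeps a survivor, which turns the upper bound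
        1 into an equality.\<close>
      moreover from this have "0 < card (alive n (arr s' ''rep''))"
        by (auto simp: reduced_state_def reduced_def card_gt_0_iff)
      ultimately show "reduced_state s' \<and> card (alive n (arr s' ''rep'')) = 1"
        using I by simp
    qed simp
  qed simp
next
  show "11 * n + 6 + (n * (228 * (n + M + 1) + 8) + 8) \<le> 250 * (n * (n + M + 1))"
    using n by (rule total_time)
qed

end

section \<open>The main result\<close>

text \<open>An undominated vertex could be added to the set, and conversely a proper independent
  superset would contain an undominated vertex. \<open>mis\<close> also tests pairs with u = v,
  hence the appeal to the absence of loops.\<close>

lemma maximal_independent_iff_mis:
  assumes "simple_graph G"
  shows "maximal_independent G I \<longleftrightarrow> mis (\<lambda>u v. {u, v} \<in> edges G) (verts G) I"
proof -
  have loop: "{u, u} \<notin> edges G" for u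
    using assms unfolding simple_graph_def by (metis doubleton_eq_iff)
  show ?thesis
  proof
    assume I: "maximal_independent G I"
    have ind: "I \<subseteq> verts G" "\<And>u v. u \<in> I \<Longrightarrow> v \<in> I \<Longrightarrow> {u, v} \<notin> edges G"
      using I loop unfolding maximal_independent_def independent_def by (blast, metis)
    have "\<exists>u\<in>I. {x, u} \<in> edges G" if x: "x \<in> verts G - I" for x
    proof (rule ccontr)
      assume "\<not> (\<exists>u\<in>I. {x, u} \<in> edges G)"
      then have "independent G (insert x I)"
        using x ind unfolding independent_def by (auto simp: insert_commute)
      then show False
        using I x unfolding maximal_independent_def by blast
    qed
    then show "mis (\<lambda>u v. {u, v} \<in> edges G) (verts G) I"
      using ind by (auto simp: mis_def)
  next
    assume I: "mis (\<lambda>u v. {u, v} \<in> edges G) (verts G) I"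
    have "J = I" if J: "independent G J" "I \<subseteq> J" for J
    proof (rule ccontr)
      assume "J \<noteq> I"
      then obtain x where x: "x \<in> J" "x \<notin> I"
        using J by blast
      then obtain u where u: "u \<in> I" "{x, u} \<in> edges G"
        using I J unfolding mis_def independent_def by blast
      then have "x \<noteq> u" "u \<in> J"
        using x J by auto
      then show False
        using u x J unfolding independent_def by blast
    qed
    moreover have "independent G I"
      using I unfolding mis_def independent_def by blast
    ultimately show "maximal_independent G I"
      unfolding maximal_independent_def by blast
  qed
qed

text \<open>Transfers the condition along the numbering of the vertices, since the machine sees only
  numbers.\<close>

lemma wcw_image:
  assumes inj: "inj_on f A" and E: "\<And>i j. i \<in> A \<Longrightarrow> j \<in> A \<Longrightarrow> E i j \<longleftrightarrow> E' (f i) (f j)"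
  shows "wcw E' (f ` A) w \<longleftrightarrow> wcw E A (w \<circ> f)"
proof -
  have mis: "mis E' (f ` A) (f ` J) \<longleftrightarrow> mis E A J" if J: "J \<subseteq> A" for J
  proof -
    have "f ` A - f ` J = f ` (A - J)"
      using inj_on_image_set_diff[OF inj _ J, of A] by simp
    moreover have "(\<forall>u\<in>J. \<forall>v\<in>J. \<not> E' (f u) (f v)) \<longleftrightarrow> (\<forall>u\<in>J. \<forall>v\<in>J. \<not> E u v)"
      using E J by blast
    moreover have "(\<forall>x\<in>A - J. \<exists>u\<in>J. E' (f x) (f u)) \<longleftrightarrow> (\<forall>x\<in>A - J. \<exists>u\<in>J. E x u)"
      using E J by blast
    ultimately show ?thesis
      using J unfolding mis_def by (simp add: image_mono)
  qed
  have sum: "sum w (f ` J) = sum (w \<circ> f) J" if "J \<subseteq> A" for J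
    by (rule sum.reindex) (rule inj_on_subset[OF inj that])
  show ?thesis
  proof
    assume w: "wcw E' (f ` A) w"
    show "wcw E A (w \<circ> f)"
      unfolding wcw_def
    proof (intro allI impI, elim conjE)
      fix I J
      assume I: "mis E A I" and J: "mis E A J"
      then have "I \<subseteq> A" "J \<subseteq> A"
        by (auto simp: mis_def)
      then show "sum (w \<circ> f) I = sum (w \<circ> f) J"
        using wcwD[OF w, of "f ` I" "f ` J"] mis sum I J by simp
    qed
  next
    assume w: "wcw E A (w \<circ> f)"
    show "wcw E' (f ` A) w"
      unfolding wcw_def
    proof (intro allI impI, elim conjE)
      fix I' J'
      assume I': "mis E' (f ` A) I'" and J': "mis E' (f ` A) J'"
      then obtain I J where IJ: "I \<subseteq> A" "J \<subseteq> A" "I' = f ` I" "J' = f ` J"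
        by (auto simp: mis_def subset_image_iff)
      then show "sum w I' = sum w J'"
        using wcwD[OF w, of I J] mis sum I' J' by simp
    qed
  qed
qed

section \<open>The input encoding and the assembly of the result\<close>

context
  fixes G :: "'a graph" and vs L
  assumes G: "simple_graph G" and L: "adjacency_lists G vs L"
begin

lemma input_facts:
  shows "distinct vs" "set vs = verts G" "length L = length vs" "length L = card (verts G)"
    "i < length L \<Longrightarrow> distinct (L ! i)" "i < length L \<Longrightarrow> set (L ! i) \<subseteq> {..<length L}"
    "i < length L \<Longrightarrow> j < length L \<Longrightarrow> j \<in> set (L ! i) \<longleftrightarrow> {vs ! i, vs ! j} \<in> edges G"
    "i < length L \<Longrightarrow> i \<notin> set (L ! i)"
proof -
  have loop: "{u, u} \<notin> edges G" for u
    using G unfolding simple_graph_def by (metis doubleton_eq_iff)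
  show vs: "distinct vs" "set vs = verts G" "length L = length vs"
    using L by (auto simp: adjacency_lists_def)
  show "length L = card (verts G)"
    using vs distinct_card by metis
  show "i < length L \<Longrightarrow> distinct (L ! i)" "i < length L \<Longrightarrow> set (L ! i) \<subseteq> {..<length L}"
    "i < length L \<Longrightarrow> j < length L \<Longrightarrow> j \<in> set (L ! i) \<longleftrightarrow> {vs ! i, vs ! j} \<in> edges G"
    "i < length L \<Longrightarrow> i \<notin> set (L ! i)"
    using L loop by (auto simp: adjacency_lists_def)
qed

lemma inj_vertex: "inj_on ((!) vs) {..<length L}"
  using input_facts(1,3) by (auto simp: inj_on_def nth_eq_iff_index_eq)

lemma image_vertex: "(!) vs ` {..<length L} = verts G"
  using input_facts(2,3) by (auto simp: set_conv_nth)

lemma well_covered_iff: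
  "well_covered_weighting G w \<longleftrightarrow> wcw (adj_in L) {..<length L} (\<lambda>i. w (vs ! i))"
proof -
  have "well_covered_weighting G w \<longleftrightarrow> wcw (\<lambda>u v. {u, v} \<in> edges G) ((!) vs ` {..<length L}) w"
    unfolding well_covered_weighting_def wcw_def image_vertex maximal_independent_iff_mis[OF G] ..
  also have "\<dots> \<longleftrightarrow> wcw (adj_in L) {..<length L} (w \<circ> (!) vs)"
    by (rule wcw_image[OF inj_vertex]) (use input_facts(7) in auto)
  finally show ?thesis
    by (simp add: comp_def)
qed

text \<open>A list entry is an arc. Sending it to its edge together with its direction, recorded as
  \<open>i < j\<close>, is injective.\<close>

lemma sum_degrees_le: "length (concat L) \<le> 2 * card (edges G)"
proof -
  let ?X = "SIGMA i:{..<length L}. set (L ! i)"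
  let ?f = "\<lambda>(i, j). ({vs ! i, vs ! j}, i < j)"
  have fin: "finite (edges G)"
    using G by (intro finite_subset[of "edges G" "Pow (verts G)"]) (auto simp: simple_graph_def)
  have "length (concat L) = (\<Sum>i<length L. length (L ! i))"
    by (simp add: length_concat sum_list_sum_nth atLeast0LessThan)
  also have "\<dots> = card ?X"
    using input_facts(5) by (simp add: distinct_card)
  also have "\<dots> \<le> card (edges G \<times> (UNIV :: bool set))"
  proof (rule card_inj_on_le)
    show "inj_on ?f ?X"
    proof (rule inj_onI, clarify)
      fix i j k l
      assume ij: "i < length L" "j \<in> set (L ! i)" "k < length L" "l \<in> set (L ! k)"
        and eq: "{vs ! i, vs ! j} = {vs ! k, vs ! l}" "(i < j) = (k < l)"
      have jl: "j < length L" "l < length L" "i \<noteq> j"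
        using input_facts(6)[OF ij(1)] input_facts(6)[OF ij(3)] input_facts(8)[OF ij(1)] ij by auto
      have "vs ! a = vs ! b \<longleftrightarrow> a = b" if "a < length L" "b < length L" for a b
        using inj_on_eq_iff[OF inj_vertex] that by simp
      then show "i = k \<and> j = l"
        using eq ij jl unfolding doubleton_eq_iff by auto
    qed
    show "?f ` ?X \<subseteq> edges G \<times> UNIV"
      using input_facts(6,7) by auto
  qed (use fin in simp)
  also have "\<dots> = 2 * card (edges G)"
    by (simp add: card_cartesian_product)
  finally show ?thesis .
qed

text \<open>The kind is read off from the pair: adjacent twins have equal closed neighbourhoods and
  nonadjacent ones equal open neighbourhoods, so \<open>adj_in L u v\<close> serves as
  \<open>q\<close>.\<close>

lemma input_twins:
  assumes "cograph G" "A \<subseteq> {..<length L}" "2 \<le> card A"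
  shows "\<exists>q u v. twins q (adj_in L) A u v"
proof -
  have "card ((!) vs ` A) = card A"
    using inj_on_subset[OF inj_vertex assms(2)] by (rule card_image)
  moreover have "finite ((!) vs ` A)" "(!) vs ` A \<subseteq> verts G"
    using assms(2) finite_subset image_vertex by (blast, blast)
  ultimately obtain u v where uv: "u \<in> A" "v \<in> A" "vs ! u \<noteq> vs ! v"
    "\<And>x. x \<in> A \<Longrightarrow> vs ! x \<noteq> vs ! u \<Longrightarrow> vs ! x \<noteq> vs ! v \<Longrightarrow>
      {vs ! u, vs ! x} \<in> edges G \<longleftrightarrow> {vs ! v, vs ! x} \<in> edges G"
    using cograph_has_twins[OF assms(1), of "(!) vs ` A"] assms(3) by auto
  have E: "adj_in L a b \<longleftrightarrow> {vs ! a, vs ! b} \<in> edges G" if "a \<in> A" "b \<in> A" for a b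
    using input_facts(7) that assms(2) by auto
  have ne: "vs ! a \<noteq> vs ! b \<longleftrightarrow> a \<noteq> b" if "a \<in> A" "b \<in> A" for a b
    using inj_on_eq_iff[OF inj_on_subset[OF inj_vertex assms(2)] that] by simp
  have irr: "\<not> adj_in L a a" if "a \<in> A" for a
    using input_facts(8) that assms(2) by auto
  have "adj_in L x u \<or> (adj_in L u v \<and> x = u) \<longleftrightarrow> adj_in L x v \<or> (adj_in L u v \<and> x = v)"
    if x: "x \<in> A" for x
  proof (cases "x = u \<or> x = v")
    case True
    then show ?thesis
      using irr uv(1,2) E[OF uv(1,2)] E[OF uv(2,1)] by (auto simp: insert_commute)
  next
    case False
    then show ?thesis
      using uv(4)[OF x] ne[OF x uv(1)] ne[OF x uv(2)] E[OF x uv(1)] E[OF x uv(2)]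
      by (auto simp: insert_commute)
  qed
  then have "twins (adj_in L u v) (adj_in L) A u v"
    using uv by (auto simp: twins_def)
  then show ?thesis
    by blast
qed

text \<open>A single remaining vertex imposes no condition, so the rows alone characterise the
  well-covered weightings. With one survivor, the count in \<open>reduced\<close> leaves at most n -
  1 rows.\<close>

lemma well_covering_of_reduced:
  assumes red: "reduced (length L) (adj_in L) rep m coeff" and card: "card (alive (length L) rep) = 1"
    and S: "length S = m" "\<And>i j. i < m \<Longrightarrow> j < length vs \<Longrightarrow> (S ! i) (vs ! j) = of_int (coeff (i * length vs + j))"
  shows "well_covering_system G S" "integer_system G S" "length S \<le> card (verts G) - 1"
proof -
  obtain a where a: "alive (length L) rep = {a}"
    using card by (auto simp: card_1_singleton_iff)
  then have "a < length L"
    by (auto simp: alive_def)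
  then have single: "wcw (adj_in L) (alive (length L) rep) w" for w
    unfolding a using input_facts(8) by (intro wcw_singleton)
  have row: "(\<Sum>v\<in>verts G. (S ! i) v * w v) =
      (\<Sum>j<length L. of_int (coeff (i * length L + j)) * w (vs ! j))" if "i < m" for i w
  proof -
    have "(\<Sum>v\<in>verts G. (S ! i) v * w v) = (\<Sum>j<length L. (S ! i) (vs ! j) * w (vs ! j))"
      unfolding image_vertex[symmetric] by (simp add: sum.reindex[OF inj_vertex])
    also have "\<dots> = (\<Sum>j<length L. of_int (coeff (i * length L + j)) * w (vs ! j))"
      using S(2)[OF that] input_facts(3) by (intro sum.cong) auto
    finally show ?thesis .
  qed
  have "well_covered_weighting G w \<longleftrightarrow>
      (\<forall>i<m. (\<Sum>j<length L. of_int (coeff (i * length L + j)) * w (vs ! j)) = 0)" for w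
    using red single unfolding well_covered_iff reduced_def by simp
  then show "well_covering_system G S"
    unfolding well_covering_system_def all_set_conv_all_nth S(1) by (simp add: row)
  show "integer_system G S"
    unfolding integer_system_def all_set_conv_all_nth S(1)
  proof (intro allI impI ballI)
    fix i v
    assume "i < m" "v \<in> verts G"
    then obtain j where "j < length vs" "v = vs ! j"
      using input_facts(2) by (metis in_set_conv_nth)
    then show "(S ! i) v \<in> \<int>"
      using S(2)[OF \<open>i < m\<close>] by simp
  qed
  show "length S \<le> card (verts G) - 1"
    using red card S(1) input_facts(4) by (auto simp: reduced_def)
qed

lemma program_correct:
  assumes co: "cograph G" and n: "n = card (verts G)" and m: "m = card (edges G)"
  shows "\<exists>t s S. exec (1000 * (n + m) ^ 2) program (input_state L) t s \<and>
    t \<le> 1000 * (n * (n + m)) \<and> outputs_system vs s S \<and>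
    integer_system G S \<and> well_covering_system G S \<and> length S \<le> n - 1"
proof -
  let ?W = "1000 * (n + m) ^ 2"
  let ?M = "length (concat L)"
  have nL: "length L = n"
    using input_facts(4) n by simp
  have "finite (verts G)"
    using G by (simp add: simple_graph_def)
  then have npos: "0 < n"
    using cograph_nonempty[OF co] n by (simp add: card_gt_0_iff)
  have M: "?M \<le> 2 * m"
    using sum_degrees_le m by simp
  \<comment> \<open>The factor 4 turns the 250 of the time bound into 1000; n \<ge> 1 absorbs the
    summand 1.\<close>
  have nM: "n + ?M + 1 \<le> 4 * (n + m)"
    using npos M by auto
  interpret machine: machine_input L ?W
  proof
    show "distinct (L ! i) \<and> set (L ! i) \<subseteq> {..<length L} \<and> i \<notin> set (L ! i)" if "i < length L" for i
      using input_facts(5,6,8)[OF that] by blast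
    show "i \<in> set (L ! j)" if "i < length L" "j \<in> set (L ! i)" for i j
    proof -
      have "j < length L"
        using input_facts(6)[OF that(1)] that(2) by auto
      then show ?thesis
        using input_facts(7)[OF that(1)] input_facts(7)[OF _ that(1)] that(2)
        by (simp add: insert_commute)
    qed
    define N where "N = n + m"
    have N: "1 \<le> N" "n \<le> N" "?M \<le> 2 * N" "n + ?M + 1 \<le> 4 * N"
      using npos M by (auto simp: N_def)
    have "n * n \<le> N * N" "2 * n * (n + ?M + 1) \<le> 2 * N * (4 * N)"
      by (rule mult_le_mono[OF N(2) N(2)], rule mult_le_mono[OF mult_le_mono2[OF N(2)] N(4)])
    moreover have "2 * N * (4 * N) = 8 * (N * N)"
      by simp
    \<comment> \<open>The contributions are at most N N, 8 N N, 2 N, N and 10 N, where N \<ge> 1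
      accounts for the constant.\<close>
    ultimately have "n * n + 2 * n * (n + ?M + 1) + ?M + n + 10 \<le> 9 * (N * N) + 13 * N"
      using N by linarith
    also have "\<dots> \<le> 1000 * (N * N)"
      using le_square[of N] by linarith
    finally have "n * n + 2 * n * (n + ?M + 1) + ?M + n + 10 \<le> 1000 * (N * N)" .
    then show "length L * length L + 2 * length L * (length L + ?M + 1) + ?M + length L + 10 \<le> ?W"
      by (simp add: nL N_def power2_eq_square)
  qed
  have in_ok: "machine.input_ok (input_state L)" and
    zero: "\<And>a k. a \<notin> {''start'', ''adj''} \<Longrightarrow> arr (input_state L) a k = 0"
    "var (input_state L) ''size'' = 0"
    by (auto simp: machine.input_ok_def input_state_def)
  have "runs ?W program (input_state L) (250 * (length L * (length L + ?M + 1)))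
      (\<lambda>s'. machine.reduced_state s' \<and> card (alive (length L) (arr s' ''rep'')) = 1)"
    by (rule machine.runs_program) (use npos nL in_ok zero input_twins[OF co] in auto)
  then obtain t s where ex: "exec ?W program (input_state L) t s"
    and t: "t \<le> 250 * (length L * (length L + ?M + 1))"
    and red: "machine.reduced_state s" and one: "card (alive (length L) (arr s ''rep'')) = 1"
    by (auto simp: runs_def)
  from red obtain k where k: "var s ''size'' = int k"
    "reduced (length L) (adj_in L) (arr s ''rep'') k (arr s ''coeff'')"
    by (auto simp: machine.reduced_state_def)
  \<comment> \<open>An equation is a function on vertices, so the inverse of the numbering finds the
    column; values outside the graph are left arbitrary.\<close>
  define S where "S = map (\<lambda>i v. real_of_int
    (arr s ''coeff'' (i * length vs + the_inv_into {..<length L} ((!) vs) v))) [0..<k]"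
  have S: "length S = k" "\<And>i j. i < k \<Longrightarrow> j < length vs \<Longrightarrow>
      (S ! i) (vs ! j) = of_int (arr s ''coeff'' (i * length vs + j))"
    using the_inv_into_f_f[OF inj_vertex] input_facts(3) by (auto simp: S_def)
  have "outputs_system vs s S"
    using S k(1) by (auto simp: outputs_system_def)
  moreover have "t \<le> 1000 * (n * (n + m))"
  proof -
    have "t \<le> 250 * (n * (n + ?M + 1))"
      using t unfolding nL .
    also have "\<dots> \<le> 250 * (n * (4 * (n + m)))"
      by (intro mult_le_mono2 nM)
    also have "\<dots> = 1000 * (n * (n + m))"
      by simp
    finally show ?thesis .
  qed
  ultimately show ?thesis
    using ex well_covering_of_reduced[OF k(2) one S] n by blast
qed

end

theorem theorem4p1:
  shows "\<exists>(P :: com) (c :: nat) (d :: nat).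
    \<forall>(G :: 'a graph) (vs :: 'a list) (L :: nat list list) (n :: nat) (m :: nat).
      simple_graph G \<and> cograph G \<and> n = card (verts G) \<and> m = card (edges G) \<and>
      adjacency_lists G vs L \<longrightarrow>
      (\<exists>t s S. exec (c * (n + m) ^ d) P (input_state L) t s \<and>
        t \<le> c * (n * (n + m)) \<and>
        outputs_system vs s S \<and>
        integer_system G S \<and> well_covering_system G S \<and> length S \<le> n - 1)"
  by (rule exI[of _ program], rule exI[of _ 1000], rule exI[of _ 2], intro allI impI, elim conjE)
    (rule program_correct)

end
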